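(* $\mathsf{ACA}_0$ proves the statement "Every infinite partial order with no infinite antichain has a $(0,\infty)$-homogeneous chain."
   Context: We work in second-order arithmetic; all partial orders have domain a subset of $\mathbb{N}$. $\mathsf{RCA}_0$ is the usual base system (discretely ordered commutative semi-ring axioms for $\mathbb{N}$, $\Sigma^0_1$ induction, $\Delta^0_1$ comprehension), and $\mathsf{ACA}_0$ is $\mathsf{RCA}_0$ plus the scheme of universal closures of $\exists X\,\forall n\,(n\in X\leftrightarrow\varphi(n))$ for arithmetical formulas $\varphi$ in which $X$ is not free. In a partial order $(P,<_P)$, elements $p,q$ are comparable if $p\leq_P q$ or $q\leq_P p$; a chain is a set of pairwise comparable elements and an antichain is a set of pairwise incomparable elements. An infinite chain $C\subseteq P$ is $(0,\infty)$-homogeneous for $P$ if every $p\in P$ is comparable with either no element of $C$ or infinitely many elements of $C$. *)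

theory Defs
  imports Main
begin

section \<open>The language of second-order arithmetic\<close>

text \<open>
  Two-sorted de Bruijn syntax. Number variables and set variables have separate index spaces:
  \<open>AllN\<close> binds number index 0 and leaves set indices alone, \<open>AllS\<close> binds set index 0 and
  leaves number indices alone. Set terms are just set variables, so they are represented by
  their index. Equality is primitive for numbers only.
\<close>

datatype tm = Var nat | Zero | One | Add tm tm | Mul tm tm

datatype fm =
    Eq tm tm
  | Less tm tm
  | Mem tm nat
  | Fls
  | Imp fm fm
  | AllN fm
  | AllS fm

definition Neg :: "fm \<Rightarrow> fm" where "Neg p = Imp p Fls"
definition Or :: "fm \<Rightarrow> fm \<Rightarrow> fm" where "Or p q = Imp (Neg p) q"
definition And :: "fm \<Rightarrow> fm \<Rightarrow> fm" where "And p q = Neg (Imp p (Neg q))"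
definition Iff :: "fm \<Rightarrow> fm \<Rightarrow> fm" where "Iff p q = And (Imp p q) (Imp q p)"
definition ExN :: "fm \<Rightarrow> fm" where "ExN p = Neg (AllN (Neg p))"
definition ExS :: "fm \<Rightarrow> fm" where "ExS p = Neg (AllS (Neg p))"

text \<open>Simultaneous capture-avoiding substitution of terms for number variables and of set
  variables for set variables.\<close>

primrec subst_tm :: "(nat \<Rightarrow> tm) \<Rightarrow> tm \<Rightarrow> tm" where
  "subst_tm \<sigma> (Var k) = \<sigma> k"
| "subst_tm \<sigma> Zero = Zero"
| "subst_tm \<sigma> One = One"
| "subst_tm \<sigma> (Add s t) = Add (subst_tm \<sigma> s) (subst_tm \<sigma> t)"
| "subst_tm \<sigma> (Mul s t) = Mul (subst_tm \<sigma> s) (subst_tm \<sigma> t)"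

definition lift_tm :: "tm \<Rightarrow> tm" where
  "lift_tm = subst_tm (\<lambda>k. Var (Suc k))"

primrec subst :: "(nat \<Rightarrow> tm) \<Rightarrow> (nat \<Rightarrow> nat) \<Rightarrow> fm \<Rightarrow> fm" where
  "subst \<sigma> \<rho> (Eq s t) = Eq (subst_tm \<sigma> s) (subst_tm \<sigma> t)"
| "subst \<sigma> \<rho> (Less s t) = Less (subst_tm \<sigma> s) (subst_tm \<sigma> t)"
| "subst \<sigma> \<rho> (Mem t X) = Mem (subst_tm \<sigma> t) (\<rho> X)"
| "subst \<sigma> \<rho> Fls = Fls"
| "subst \<sigma> \<rho> (Imp p q) = Imp (subst \<sigma> \<rho> p) (subst \<sigma> \<rho> q)"
| "subst \<sigma> \<rho> (AllN p) = AllN (subst (case_nat (Var 0) (\<lambda>k. lift_tm (\<sigma> k))) \<rho> p)"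
| "subst \<sigma> \<rho> (AllS p) = AllS (subst \<sigma> (case_nat 0 (\<lambda>k. Suc (\<rho> k))) p)"

definition liftN :: "fm \<Rightarrow> fm" where "liftN = subst (\<lambda>k. Var (Suc k)) id"
definition liftS :: "fm \<Rightarrow> fm" where "liftS = subst Var Suc"

text \<open>Instantiation of the variable with index 0; the remaining free indices move down by 1.\<close>

definition instN :: "tm \<Rightarrow> fm \<Rightarrow> fm" where "instN t = subst (case_nat t Var) id"
definition instS :: "nat \<Rightarrow> fm \<Rightarrow> fm" where "instS X = subst Var (case_nat X id)"

primrec fv_tm :: "tm \<Rightarrow> nat set" where
  "fv_tm (Var k) = {k}"
| "fv_tm Zero = {}"
| "fv_tm One = {}"
| "fv_tm (Add s t) = fv_tm s \<union> fv_tm t"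
| "fv_tm (Mul s t) = fv_tm s \<union> fv_tm t"

primrec fvN :: "fm \<Rightarrow> nat set" where
  "fvN (Eq s t) = fv_tm s \<union> fv_tm t"
| "fvN (Less s t) = fv_tm s \<union> fv_tm t"
| "fvN (Mem t X) = fv_tm t"
| "fvN Fls = {}"
| "fvN (Imp p q) = fvN p \<union> fvN q"
| "fvN (AllN p) = {k. Suc k \<in> fvN p}"
| "fvN (AllS p) = fvN p"

primrec fvS :: "fm \<Rightarrow> nat set" where
  "fvS (Eq s t) = {}"
| "fvS (Less s t) = {}"
| "fvS (Mem t X) = {X}"
| "fvS Fls = {}"
| "fvS (Imp p q) = fvS p \<union> fvS q"
| "fvS (AllN p) = fvS p"
| "fvS (AllS p) = {k. Suc k \<in> fvS p}"

definition univ_closures :: "fm \<Rightarrow> fm set" where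
  "univ_closures p =
     {(AllN ^^ m) ((AllS ^^ n) p) | m n. fvN p \<subseteq> {..<m} \<and> fvS p \<subseteq> {..<n}}"


section \<open>Provability\<close>

text \<open>Classical two-sorted natural deduction with equality. The eigenvariable condition of the
  two universal introduction rules is expressed by lifting all hypotheses.\<close>

inductive proves :: "fm set \<Rightarrow> fm \<Rightarrow> bool" (infix "\<turnstile>" 45) where
  Assm: "p \<in> \<Gamma> \<Longrightarrow> \<Gamma> \<turnstile> p"
| ImpI: "insert p \<Gamma> \<turnstile> q \<Longrightarrow> \<Gamma> \<turnstile> Imp p q"
| ImpE: "\<Gamma> \<turnstile> Imp p q \<Longrightarrow> \<Gamma> \<turnstile> p \<Longrightarrow> \<Gamma> \<turnstile> q"
| Contr: "insert (Neg p) \<Gamma> \<turnstile> Fls \<Longrightarrow> \<Gamma> \<turnstile> p"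
| AllNI: "liftN ` \<Gamma> \<turnstile> p \<Longrightarrow> \<Gamma> \<turnstile> AllN p"
| AllNE: "\<Gamma> \<turnstile> AllN p \<Longrightarrow> \<Gamma> \<turnstile> instN t p"
| AllSI: "liftS ` \<Gamma> \<turnstile> p \<Longrightarrow> \<Gamma> \<turnstile> AllS p"
| AllSE: "\<Gamma> \<turnstile> AllS p \<Longrightarrow> \<Gamma> \<turnstile> instS X p"
| EqRefl: "\<Gamma> \<turnstile> Eq t t"
| EqSubst: "\<Gamma> \<turnstile> Eq s t \<Longrightarrow> \<Gamma> \<turnstile> instN s p \<Longrightarrow> \<Gamma> \<turnstile> instN t p"


section \<open>The axiom systems\<close>

text \<open>Kaye's axioms for (the nonnegative parts of) discretely ordered commutative rings; their
  universal closures are taken in \<open>RCA0\<close> below.\<close>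

definition semiring_axioms :: "fm set" where
  "semiring_axioms =
    (let x = Var 0; y = Var 1; z = Var 2 in
     {Eq (Add (Add x y) z) (Add x (Add y z)),
      Eq (Add x y) (Add y x),
      Eq (Mul (Mul x y) z) (Mul x (Mul y z)),
      Eq (Mul x y) (Mul y x),
      Eq (Mul x (Add y z)) (Add (Mul x y) (Mul x z)),
      Eq (Add x Zero) x,
      Eq (Mul x Zero) Zero,
      Eq (Mul x One) x,
      Imp (And (Less x y) (Less y z)) (Less x z),
      Neg (Less x x),
      Or (Less x y) (Or (Eq x y) (Less y x)),
      Imp (Less x y) (Less (Add x z) (Add y z)),
      Imp (And (Less Zero z) (Less x y)) (Less (Mul x z) (Mul y z)),
      Imp (Less x y) (ExN (Eq (Add (lift_tm x) (Var 0)) (lift_tm y))),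
      Less Zero One,
      Imp (Less Zero x) (Or (Less One x) (Eq One x)),
      Or (Less Zero x) (Eq Zero x)})"

inductive bounded :: "fm \<Rightarrow> bool" where
  "bounded (Eq s t)"
| "bounded (Less s t)"
| "bounded (Mem t X)"
| "bounded Fls"
| "bounded p \<Longrightarrow> bounded q \<Longrightarrow> bounded (Imp p q)"
| "bounded p \<Longrightarrow> bounded (AllN (Imp (Less (Var 0) (lift_tm t)) p))"
| "bounded p \<Longrightarrow> bounded (ExN (And (Less (Var 0) (lift_tm t)) p))"

definition Sigma01 :: "fm set" where "Sigma01 = {ExN p | p. bounded p}"
definition Pi01 :: "fm set" where "Pi01 = {AllN p | p. bounded p}"

primrec arithmetical :: "fm \<Rightarrow> bool" where
  "arithmetical (Eq s t) = True"
| "arithmetical (Less s t) = True"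
| "arithmetical (Mem t X) = True"
| "arithmetical Fls = True"
| "arithmetical (Imp p q) = (arithmetical p \<and> arithmetical q)"
| "arithmetical (AllN p) = arithmetical p"
| "arithmetical (AllS p) = False"

text \<open>In the schemes below number index 0 of \<open>p\<close> is the distinguished variable \<open>n\<close>; all other
  free variables of \<open>p\<close>, of either sort, are parameters.\<close>

definition induction_ax :: "fm \<Rightarrow> fm" where
  "induction_ax p =
     Imp (And (instN Zero p)
              (AllN (Imp p (subst (case_nat (Add (Var 0) One) (\<lambda>k. Var (Suc k))) id p))))
         (AllN p)"

text \<open>Lifting \<open>p\<close> makes the comprehended set, which has set index 0, not free in it.\<close>

definition comprehension_ax :: "fm \<Rightarrow> fm" where
  "comprehension_ax p = ExS (AllN (Iff (Mem (Var 0) 0) (liftS p)))"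

definition RCA0 :: "fm set" where
  "RCA0 = (\<Union>p\<in>semiring_axioms. univ_closures p)
        \<union> (\<Union>p\<in>Sigma01. univ_closures (induction_ax p))
        \<union> (\<Union>p\<in>Sigma01. \<Union>q\<in>Pi01.
             univ_closures (Imp (AllN (Iff p q)) (comprehension_ax p)))"

definition ACA0 :: "fm set" where
  "ACA0 = RCA0 \<union> (\<Union>p\<in>{p. arithmetical p}. univ_closures (comprehension_ax p))"


section \<open>Partial orders in second-order arithmetic\<close>

text \<open>A binary relation is a set of codes \<open>(i, j) = (i + j)\<^sup>2 + i\<close> of pairs. The set indices \<open>P\<close>
  and \<open>L\<close> stand for the domain of a partial order and for its strict order relation.\<close>

definition pair :: "tm \<Rightarrow> tm \<Rightarrow> tm" where
  "pair s t = Add (Mul (Add s t) (Add s t)) s"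

definition lt_in :: "nat \<Rightarrow> tm \<Rightarrow> tm \<Rightarrow> fm" where
  "lt_in L s t = Mem (pair s t) L"

definition le_in :: "nat \<Rightarrow> tm \<Rightarrow> tm \<Rightarrow> fm" where
  "le_in L s t = Or (lt_in L s t) (Eq s t)"

definition comparable :: "nat \<Rightarrow> tm \<Rightarrow> tm \<Rightarrow> fm" where
  "comparable L s t = Or (le_in L s t) (le_in L t s)"

definition subset_fm :: "nat \<Rightarrow> nat \<Rightarrow> fm" where
  "subset_fm X Y = AllN (Imp (Mem (Var 0) X) (Mem (Var 0) Y))"

definition infinite_fm :: "nat \<Rightarrow> fm" where
  "infinite_fm X = AllN (ExN (And (Less (Var 1) (Var 0)) (Mem (Var 0) X)))"

definition partial_order_fm :: "nat \<Rightarrow> nat \<Rightarrow> fm" where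
  "partial_order_fm P L =
     And (AllN (Imp (Mem (Var 0) L)
            (ExN (ExN (And (Eq (Var 2) (pair (Var 1) (Var 0)))
                           (And (Mem (Var 1) P) (Mem (Var 0) P)))))))
    (And (AllN (Imp (Mem (Var 0) P) (Neg (lt_in L (Var 0) (Var 0)))))
         (AllN (AllN (AllN
            (Imp (And (Mem (Var 2) P) (And (Mem (Var 1) P) (Mem (Var 0) P)))
                 (Imp (And (lt_in L (Var 2) (Var 1)) (lt_in L (Var 1) (Var 0)))
                      (lt_in L (Var 2) (Var 0))))))))"

definition chain_fm :: "nat \<Rightarrow> nat \<Rightarrow> nat \<Rightarrow> fm" where
  "chain_fm P L C =
     And (subset_fm C P)
         (AllN (AllN (Imp (And (Mem (Var 1) C) (Mem (Var 0) C))
                          (comparable L (Var 1) (Var 0)))))"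

definition antichain_fm :: "nat \<Rightarrow> nat \<Rightarrow> nat \<Rightarrow> fm" where
  "antichain_fm P L A =
     And (subset_fm A P)
         (AllN (AllN (Imp (And (Mem (Var 1) A) (And (Mem (Var 0) A) (Neg (Eq (Var 1) (Var 0)))))
                          (Neg (comparable L (Var 1) (Var 0))))))"

definition zero_inf_homogeneous_fm :: "nat \<Rightarrow> nat \<Rightarrow> nat \<Rightarrow> fm" where
  "zero_inf_homogeneous_fm P L C =
     And (And (infinite_fm C) (chain_fm P L C))
         (AllN (Imp (Mem (Var 0) P)
            (Or (Neg (ExN (And (Mem (Var 0) C) (comparable L (Var 1) (Var 0)))))
                (AllN (ExN (And (Less (Var 1) (Var 0))
                                (And (Mem (Var 0) C) (comparable L (Var 2) (Var 0)))))))))"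

definition rival_sands_fm :: fm where
  "rival_sands_fm =
     AllS (AllS (Imp
       (And (partial_order_fm 1 0)
       (And (infinite_fm 1)
            (Neg (ExS (And (infinite_fm 0) (antichain_fm 2 1 0))))))
       (ExS (zero_inf_homogeneous_fm 2 1 0))))"


section \<open>Reading the sentence\<close>

text \<open>Tarski semantics, with \<open>S\<close> the range of the set quantifiers, over structures whose
  first-order part is standard. The reading lemma unfolds the encoded sentence.\<close>

primrec val :: "(nat \<Rightarrow> nat) \<Rightarrow> tm \<Rightarrow> nat" where
  "val e (Var k) = e k"
| "val e Zero = 0"
| "val e One = 1"
| "val e (Add s t) = val e s + val e t"
| "val e (Mul s t) = val e s * val e t"

primrec sat :: "nat set set \<Rightarrow> (nat \<Rightarrow> nat) \<Rightarrow> (nat \<Rightarrow> nat set) \<Rightarrow> fm \<Rightarrow> bool" where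
  "sat S e f (Eq s t) = (val e s = val e t)"
| "sat S e f (Less s t) = (val e s < val e t)"
| "sat S e f (Mem t X) = (val e t \<in> f X)"
| "sat S e f Fls = False"
| "sat S e f (Imp p q) = (sat S e f p \<longrightarrow> sat S e f q)"
| "sat S e f (AllN p) = (\<forall>n. sat S (case_nat n e) f p)"
| "sat S e f (AllS p) = (\<forall>X\<in>S. sat S e (case_nat X f) p)"

lemma sat_defined [simp]:
  "sat S e f (Neg p) = (\<not> sat S e f p)"
  "sat S e f (Or p q) = (sat S e f p \<or> sat S e f q)"
  "sat S e f (And p q) = (sat S e f p \<and> sat S e f q)"
  "sat S e f (Iff p q) = (sat S e f p \<longleftrightarrow> sat S e f q)"
  "sat S e f (ExN p) = (\<exists>n. sat S (case_nat n e) f p)"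
  "sat S e f (ExS p) = (\<exists>X\<in>S. sat S e (case_nat X f) p)"
  by (auto simp: Neg_def Or_def And_def Iff_def ExN_def ExS_def)

lemma val_subst: "val e (subst_tm \<sigma> t) = val (\<lambda>k. val e (\<sigma> k)) t"
  by (induction t) auto

lemma val_lift [simp]: "val (case_nat n e) (lift_tm t) = val e t"
  by (simp add: lift_tm_def val_subst)

lemma sat_subst: "sat S e f (subst \<sigma> \<rho> p) = sat S (\<lambda>k. val e (\<sigma> k)) (\<lambda>k. f (\<rho> k)) p"
proof (induction p arbitrary: e f \<sigma> \<rho>)
  case (AllN p)
  have "(\<lambda>k. val (case_nat n e) (case k of 0 \<Rightarrow> Var 0 | Suc k \<Rightarrow> lift_tm (\<sigma> k)))
      = case_nat n (\<lambda>k. val e (\<sigma> k))" for n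
    by (auto split: nat.split)
  then show ?case by (simp add: AllN.IH)
next
  case (AllS p)
  have "(\<lambda>k. case_nat X f (case k of 0 \<Rightarrow> 0 | Suc k \<Rightarrow> Suc (\<rho> k)))
      = case_nat X (\<lambda>k. f (\<rho> k))" for X
    by (rule ext) (simp split: nat.split)
  then show ?case by (simp add: AllS.IH)
qed (auto simp: val_subst)

lemma sat_lift [simp]:
  "sat S (case_nat n e) f (liftN p) = sat S e f p"
  "sat S e (case_nat X f) (liftS p) = sat S e f p"
  by (simp_all add: liftN_def liftS_def sat_subst)

lemma sat_inst [simp]:
  "sat S e f (instN t p) = sat S (case_nat (val e t) e) f p"
  "sat S e f (instS X p) = sat S e (case_nat (f X) f) p"
proof -
  have "(\<lambda>k. val e (case_nat t Var k)) = case_nat (val e t) e"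
    and "(\<lambda>k. f (case_nat X id k)) = case_nat (f X) f"
    by (rule ext, simp split: nat.split)+
  then show "sat S e f (instN t p) = sat S (case_nat (val e t) e) f p"
    and "sat S e f (instS X p) = sat S e (case_nat (f X) f) p"
    by (simp_all add: instN_def instS_def sat_subst)
qed

lemma proves_sound:
  assumes "\<Gamma> \<turnstile> p" "range f \<subseteq> S" "\<forall>q\<in>\<Gamma>. sat S e f q"
  shows "sat S e f p"
  using assms
proof (induction arbitrary: e f)
  case (AllSI \<Gamma> p)
  have "range (case_nat X f) \<subseteq> S" if "X \<in> S" for X
    using AllSI.prems(1) that by (auto simp: image_subset_iff split: nat.split)
  with AllSI show ?case by simp
next
  case (AllSE \<Gamma> p X)
  then show ?case by (simp add: image_subset_iff)
qed auto

lemma sat_univ_closures: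
  assumes "\<And>e f. range f \<subseteq> S \<Longrightarrow> sat S e f p" "q \<in> univ_closures p" "range f \<subseteq> S"
  shows "sat S e f q"
proof -
  have allS: "sat S e f ((AllS ^^ n) p)" if "range f \<subseteq> S" for n e f
    using that
  proof (induction n arbitrary: f)
    case (Suc n)
    have "range (case_nat X f) \<subseteq> S" if "X \<in> S" for X
      using Suc.prems that by (auto simp: image_subset_iff split: nat.split)
    with Suc show ?case by simp
  qed (simp add: assms(1))
  have "sat S e f ((AllN ^^ m) ((AllS ^^ n) p))" for m n
    by (induction m arbitrary: e) (simp_all add: allS assms(3))
  with assms(2) show ?thesis by (auto simp: univ_closures_def)
qed

lemma sat_ACA0:
  assumes "p \<in> ACA0"
  shows "sat UNIV e f p"
proof -
  have 1: "sat UNIV e f q" if "q \<in> semiring_axioms" for q e f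
  proof -
    have diff: "a < b \<longrightarrow> (\<exists>z. z + a = b)" for a b :: nat
      by presburger
    show ?thesis
      using that unfolding semiring_axioms_def Let_def
      by - (elim insertE emptyE; simp add: algebra_simps; (rule diff | linarith)?)
  qed
  have 2: "sat UNIV e f (induction_ax q)" for q e f
  proof -
    have eq: "(\<lambda>k. val (case_nat n e) (case k of 0 \<Rightarrow> Add (Var 0) One | Suc k \<Rightarrow> Var (Suc k)))
        = case_nat (Suc n) e" for n
      by (auto split: nat.split)
    have step: "sat UNIV (case_nat n e) f
           (subst (case_nat (Add (Var 0) One) (\<lambda>k. Var (Suc k))) id q)
        = sat UNIV (case_nat (Suc n) e) f q" for n
      unfolding sat_subst eq id_apply by (rule refl)
    show ?thesis
      unfolding induction_ax_def sat_defined sat.simps sat_inst val.simps step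
      using nat_induct[of "\<lambda>n. sat UNIV (case_nat n e) f q"] by blast
  qed
  have 3: "sat UNIV e f (comprehension_ax q)" for q e f
  proof -
    have "\<forall>n. n \<in> {n. sat UNIV (case_nat n e) f q} \<longleftrightarrow> sat UNIV (case_nat n e) f q"
      by simp
    then show ?thesis
      unfolding comprehension_ax_def sat_defined sat.simps sat_lift val.simps nat.case by blast
  qed
  have 4: "sat UNIV e f (Imp r (comprehension_ax q))" for r q e f
    by (simp add: 3)
  have "\<exists>q. p \<in> univ_closures q \<and> (\<forall>e f. sat UNIV e f q)"
    using assms unfolding ACA0_def RCA0_def
  proof (elim UnE UN_E)
    fix q assume "q \<in> semiring_axioms" "p \<in> univ_closures q"
    with 1 show ?thesis by blast
  next
    fix q assume "p \<in> univ_closures (induction_ax q)"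
    with 2 show ?thesis by blast
  next
    fix q r assume "p \<in> univ_closures (Imp (AllN (Iff q r)) (comprehension_ax q))"
    with 4 show ?thesis by blast
  next
    fix q assume "p \<in> univ_closures (comprehension_ax q)"
    with 3 show ?thesis by blast
  qed
  then obtain q where "p \<in> univ_closures q" "\<And>e f. sat UNIV e f q" by blast
  then show ?thesis using sat_univ_closures[of UNIV q p f e] by simp
qed

theorem ACA0_consistent: "\<not> ACA0 \<turnstile> Fls"
proof
  assume "ACA0 \<turnstile> Fls"
  then have "sat UNIV (\<lambda>_. 0) (\<lambda>_. {}) Fls"
    by (rule proves_sound) (simp_all add: sat_ACA0)
  then show False by simp
qed

lemma rival_sands_reading:
  "sat S e f rival_sands_fm \<longleftrightarrow>
   (\<forall>P\<in>S. \<forall>L\<in>S.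
     let lt = (\<lambda>p q. (p + q) * (p + q) + p \<in> L);
         comp = (\<lambda>p q. (lt p q \<or> p = q) \<or> (lt q p \<or> q = p));
         inf = (\<lambda>X. \<forall>m. \<exists>n>m. n \<in> X)
     in (\<forall>n\<in>L. \<exists>p q. n = (p + q) * (p + q) + p \<and> p \<in> P \<and> q \<in> P)
        \<and> (\<forall>p\<in>P. \<not> lt p p)
        \<and> (\<forall>p q r. p \<in> P \<and> q \<in> P \<and> r \<in> P \<longrightarrow> lt p q \<and> lt q r \<longrightarrow> lt p r)
        \<and> inf P
        \<and> \<not> (\<exists>A\<in>S. inf A \<and> A \<subseteq> P \<and> (\<forall>p\<in>A. \<forall>q\<in>A. p \<noteq> q \<longrightarrow> \<not> comp p q))
        \<longrightarrow> (\<exists>C\<in>S. inf C \<and> C \<subseteq> P \<and> (\<forall>p\<in>C. \<forall>q\<in>C. comp p q)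
             \<and> (\<forall>p\<in>P. \<not> (\<exists>c\<in>C. comp p c) \<or> (\<forall>m. \<exists>c>m. c \<in> C \<and> comp p c))))"
proof -
  have idx: "case_nat a g 1 = g 0" "case_nat a g 2 = g 1" for a :: 'b and g
    by (simp_all add: numeral_2_eq_2)
  show ?thesis
    unfolding rival_sands_fm_def zero_inf_homogeneous_fm_def antichain_fm_def chain_fm_def
      partial_order_fm_def infinite_fm_def subset_fm_def comparable_def le_in_def lt_in_def
      pair_def Let_def sat.simps sat_defined val.simps idx nat.case
    by (simp add: idx subset_iff Ball_def Bex_def imp_conjL)
qed

end

theory Submission
  imports Defs "HOL-Library.Countable"
begin

text \<open>
  A sentence that \<open>ACA0\<close> does not prove is false in some model of \<open>ACA0\<close>, possibly with
  nonstandard numbers. So it suffices to prove the Rival-Sands statement inside an arbitrary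
  model, with ordinary mathematical reasoning that uses only the closure properties of its
  family of sets.

  The model comes from Henkin's construction (\<open>henkin_extension\<close>, \<open>term_model_truth\<close>). Since
  the axioms are sentences, every variable is free to serve as a witness, and no new constants
  are required: the terms modulo provable equality are the numbers, and the set variables name
  the sets. The numbers are a discretely ordered semiring, and the locale \<open>aca_structure\<close>
  records what else survives of the axioms, namely set induction and arithmetical comprehension.
  Definability by formulas is then replaced by a calculus of arithmetical predicates (\<open>arith\<close>).
  After finite sequences have been coded by numbers, it yields definition by recursion and
  dependent choice for arithmetical relations (\<open>dependent_choice\<close>).

  The combinatorial part concerns an unbounded partial order without unbounded antichains. The
  absence of antichains is used mostly through \<open>compatible_above\<close>: for sets \<open>X\<close> and \<open>C\<close> with
  \<open>C\<close> nonempty there is \<open>c \<in> C\<close> such that any \<open>x \<in> X\<close> and \<open>c' \<in> C\<close> above \<open>c\<close> have an upper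
  bound in \<open>X\<close>. Call a nonempty directed set without a maximum an ideal. The order or its dual
  contains an ideal (\<open>ideal_or_filter\<close>), and homogeneity is self-dual, so let \<open>D\<close> be an ideal.

  A chain cofinal in \<open>D\<close> can fail to be homogeneous only through elements \<open>p\<close> that lie above
  members of \<open>D\<close> without being an upper bound of \<open>D\<close> and without lying below a member of \<open>D\<close>
  (\<open>exists_obstruction\<close>). Above every non-upper-bound that is high enough there is a \<open>v\<close> for
  which the elements above \<open>v\<close> that are not upper bounds of \<open>D\<close> form an ideal again, a child of
  \<open>D\<close> (\<open>child_ideal\<close>). The obstructions to a child of \<open>D\<close> are upper bounds of \<open>D\<close>.

  Suppose that there is no homogeneous chain. Let \<open>U\<close> consist of the elements that lie below a
  member of an ideal obtained from a first ideal by finitely many passages to a child. By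
  \<open>compatible_above\<close> the set \<open>U\<close> is directed above some \<open>y \<in> U\<close>. Take an ideal \<open>A\<close> of the family
  with a member above \<open>y\<close>. High enough elements that are not upper bounds of \<open>A\<close> lie below
  members of children of \<open>A\<close>, hence belong to \<open>U\<close>; and the obstructions to a child of \<open>A\<close>
  provide an upper bound \<open>w \<in> U\<close> of \<open>A\<close>. Then a chain cofinal in \<open>A\<close>, followed by a chain that
  starts at \<open>w\<close> and is cofinal in the part of \<open>U\<close> above \<open>y\<close>, is homogeneous: whatever is above
  an element of the lower chain either bounds all of it or lies below the upper chain.

  A maximal ideal would give a homogeneous chain at once, but its construction, by Zorn's lemma
  or transfinite iteration, is not arithmetical. Finitely many steps are: an iterated child is
  determined by the finite sequence of its vertices \<open>v\<close>, and this is what makes \<open>U\<close> arithmetical.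
\<close>

section \<open>Substitution\<close>

instance tm :: countable by countable_datatype
instance fm :: countable by countable_datatype

text \<open>
  Names for the liftings of substitutions under binders, so that substitution can be stated to
  commute with binders by rewrite rules that do not mention \<open>case_nat\<close>.
\<close>

definition up :: "(nat \<Rightarrow> tm) \<Rightarrow> nat \<Rightarrow> tm" where
  "up \<sigma> = case_nat (Var 0) (\<lambda>k. lift_tm (\<sigma> k))"

definition upS :: "(nat \<Rightarrow> nat) \<Rightarrow> nat \<Rightarrow> nat" where
  "upS \<rho> = case_nat 0 (\<lambda>k. Suc (\<rho> k))"

lemma subst_AllN [simp]: "subst \<sigma> \<rho> (AllN p) = AllN (subst (up \<sigma>) \<rho> p)"
  and subst_AllS [simp]: "subst \<sigma> \<rho> (AllS p) = AllS (subst \<sigma> (upS \<rho>) p)"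
  by (simp_all add: up_def upS_def)

declare subst.simps(6,7) [simp del]

lemma up_simps [simp]: "up \<sigma> 0 = Var 0" "up \<sigma> (Suc k) = lift_tm (\<sigma> k)"
  and upS_simps [simp]: "upS \<rho> 0 = 0" "upS \<rho> (Suc k) = Suc (\<rho> k)"
  by (simp_all add: up_def upS_def)

lemma subst_tm_comp: "subst_tm \<sigma> (subst_tm \<tau> t) = subst_tm (\<lambda>k. subst_tm \<sigma> (\<tau> k)) t"
  by (induction t) auto

lemma subst_tm_cong: "(\<And>k. k \<in> fv_tm t \<Longrightarrow> \<sigma> k = \<tau> k) \<Longrightarrow> subst_tm \<sigma> t = subst_tm \<tau> t"
  by (induction t) auto

lemma subst_tm_Var [simp]: "subst_tm Var t = t"
  by (induction t) auto

lemma subst_cong: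
  "(\<And>k. k \<in> fvN p \<Longrightarrow> \<sigma> k = \<tau> k) \<Longrightarrow> (\<And>k. k \<in> fvS p \<Longrightarrow> \<rho> k = \<pi> k) \<Longrightarrow>
   subst \<sigma> \<rho> p = subst \<tau> \<pi> p"
proof (induction p arbitrary: \<sigma> \<tau> \<rho> \<pi>)
  case (AllN p)
  have "up \<sigma> k = up \<tau> k" if "k \<in> fvN p" for k
    using that AllN.prems(1) by (cases k) auto
  then have "subst (up \<sigma>) \<rho> p = subst (up \<tau>) \<pi> p"
    using AllN.prems(2) by (intro AllN.IH) auto
  then show ?case by simp
next
  case (AllS p)
  have "upS \<rho> k = upS \<pi> k" if "k \<in> fvS p" for k
    using that AllS.prems(2) by (cases k) auto
  then have "subst \<sigma> (upS \<rho>) p = subst \<tau> (upS \<pi>) p"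
    using AllS.prems(1) by (intro AllS.IH) auto
  then show ?case by simp
next
  case (Eq s t)
  show ?case using Eq(1) by (auto intro!: subst_tm_cong)
next
  case (Less s t)
  show ?case using Less(1) by (auto intro!: subst_tm_cong)
next
  case (Mem t X)
  show ?case using Mem by (auto intro!: subst_tm_cong)
next
  case (Imp p q)
  have "subst \<sigma> \<rho> p = subst \<tau> \<pi> p" "subst \<sigma> \<rho> q = subst \<tau> \<pi> q"
    using Imp.prems by (auto intro!: Imp.IH)
  then show ?case by simp
qed auto

lemma up_comp: "(\<lambda>k. subst_tm (up \<sigma>) (up \<tau> k)) = up (\<lambda>k. subst_tm \<sigma> (\<tau> k))"
proof
  fix k show "subst_tm (up \<sigma>) (up \<tau> k) = up (\<lambda>k. subst_tm \<sigma> (\<tau> k)) k"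
    by (cases k) (simp_all add: lift_tm_def subst_tm_comp)
qed

lemma upS_comp: "(\<lambda>k. upS \<rho> (upS \<pi> k)) = upS (\<lambda>k. \<rho> (\<pi> k))"
proof
  fix k show "upS \<rho> (upS \<pi> k) = upS (\<lambda>k. \<rho> (\<pi> k)) k" by (cases k) simp_all
qed

lemma subst_comp:
  "subst \<sigma> \<rho> (subst \<tau> \<pi> p) = subst (\<lambda>k. subst_tm \<sigma> (\<tau> k)) (\<lambda>k. \<rho> (\<pi> k)) p"
  by (induction p arbitrary: \<sigma> \<rho> \<tau> \<pi>) (simp_all add: subst_tm_comp up_comp upS_comp)

lemma up_Var [simp]: "up Var = Var" and upS_id [simp]: "upS id = id" "upS (\<lambda>k. k) = (\<lambda>k. k)"
proof -
  show "up Var = Var"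
  proof
    fix k show "up Var k = Var k" by (cases k) (simp_all add: lift_tm_def)
  qed
  show "upS id = id"
  proof
    fix k show "upS id k = id k" by (cases k) simp_all
  qed
  then show "upS (\<lambda>k. k) = (\<lambda>k. k)" by (simp add: id_def)
qed

lemma subst_Var [simp]: "subst Var id p = p" "subst Var (\<lambda>k. k) p = p"
proof -
  show "subst Var id p = p"
    by (induction p) simp_all
  then show "subst Var (\<lambda>k. k) p = p" by (simp add: id_def)
qed

lemma subst_closed: "fvN p = {} \<Longrightarrow> fvS p = {} \<Longrightarrow> subst \<sigma> \<rho> p = p"
  using subst_cong[of p \<sigma> Var \<rho> id] by simp

lemma fv_defined [simp]:
  "fvN (Neg p) = fvN p" "fvN (And p q) = fvN p \<union> fvN q" "fvN (Or p q) = fvN p \<union> fvN q"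
  "fvN (Iff p q) = fvN p \<union> fvN q"
  "fvN (ExN p) = {k. Suc k \<in> fvN p}" "fvN (ExS p) = fvN p"
  "fvS (Neg p) = fvS p" "fvS (And p q) = fvS p \<union> fvS q" "fvS (Or p q) = fvS p \<union> fvS q"
  "fvS (Iff p q) = fvS p \<union> fvS q"
  "fvS (ExN p) = fvS p" "fvS (ExS p) = {k. Suc k \<in> fvS p}"
  by (auto simp: Neg_def And_def Or_def Iff_def ExN_def ExS_def)

lemma subst_Neg [simp]: "subst \<sigma> \<rho> (Neg p) = Neg (subst \<sigma> \<rho> p)"
  by (simp add: Neg_def)

lemma finite_fv_tm [simp]: "finite (fv_tm t)"
  by (induction t) auto

lemma finite_pred_image: "finite A \<Longrightarrow> finite {k. Suc k \<in> A}"
  using finite_vimageI[of A Suc] by (simp add: vimage_def)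

lemma finite_fv [simp]: "finite (fvN p)" "finite (fvS p)"
  by (induction p) (auto intro: finite_pred_image)

section \<open>Derivations\<close>

lemma weaken: "\<Gamma> \<turnstile> p \<Longrightarrow> \<Gamma> \<subseteq> \<Delta> \<Longrightarrow> \<Delta> \<turnstile> p"
proof (induction arbitrary: \<Delta> rule: proves.induct)
  case (ImpI p \<Gamma> q)
  then show ?case by (meson insert_mono proves.ImpI)
next
  case (Contr p \<Gamma>)
  then show ?case by (meson insert_mono proves.Contr)
next
  case (AllNI \<Gamma> p)
  then show ?case by (meson image_mono proves.AllNI)
next
  case (AllSI \<Gamma> p)
  then show ?case by (meson image_mono proves.AllSI)
next
  case (ImpE \<Gamma> p q)
  then show ?case by (meson proves.ImpE)
next
  case (EqSubst \<Gamma> s t p)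
  then show ?case by (meson proves.EqSubst)
qed (auto intro: proves.Assm proves.AllNE proves.AllSE proves.EqRefl)

lemma finite_support: "\<Gamma> \<turnstile> p \<Longrightarrow> \<exists>\<Delta>. finite \<Delta> \<and> \<Delta> \<subseteq> \<Gamma> \<and> \<Delta> \<turnstile> p"
proof (induction rule: proves.induct)
  case (Assm p \<Gamma>)
  then show ?case by (intro exI[of _ "{p}"]) (auto intro: proves.Assm)
next
  case (ImpI p \<Gamma> q)
  then obtain \<Delta> where D: "finite \<Delta>" "\<Delta> \<subseteq> insert p \<Gamma>" "\<Delta> \<turnstile> q" by blast
  have "insert p (\<Delta> - {p}) \<turnstile> q" by (rule weaken[OF D(3)]) auto
  then have "\<Delta> - {p} \<turnstile> Imp p q" by (rule proves.ImpI)
  with D show ?case by (intro exI[of _ "\<Delta> - {p}"]) auto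
next
  case (ImpE \<Gamma> p q)
  then obtain \<Delta> \<Delta>' where D: "finite \<Delta>" "\<Delta> \<subseteq> \<Gamma>" "\<Delta> \<turnstile> Imp p q" "finite \<Delta>'" "\<Delta>' \<subseteq> \<Gamma>" "\<Delta>' \<turnstile> p"
    by blast
  have "\<Delta> \<union> \<Delta>' \<turnstile> Imp p q" "\<Delta> \<union> \<Delta>' \<turnstile> p"
    by (rule weaken[OF D(3)], simp) (rule weaken[OF D(6)], simp)
  then have "\<Delta> \<union> \<Delta>' \<turnstile> q" by (rule proves.ImpE)
  with D show ?case by (intro exI[of _ "\<Delta> \<union> \<Delta>'"]) auto
next
  case (Contr p \<Gamma>)
  then obtain \<Delta> where D: "finite \<Delta>" "\<Delta> \<subseteq> insert (Neg p) \<Gamma>" "\<Delta> \<turnstile> Fls" by blast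
  have "insert (Neg p) (\<Delta> - {Neg p}) \<turnstile> Fls" by (rule weaken[OF D(3)]) auto
  then have "\<Delta> - {Neg p} \<turnstile> p" by (rule proves.Contr)
  with D show ?case by (intro exI[of _ "\<Delta> - {Neg p}"]) auto
next
  case (AllNI \<Gamma> p)
  then obtain \<Delta> where D: "finite \<Delta>" "\<Delta> \<subseteq> liftN ` \<Gamma>" "\<Delta> \<turnstile> p" by blast
  then obtain \<Delta>' where "finite \<Delta>'" "\<Delta>' \<subseteq> \<Gamma>" "\<Delta> = liftN ` \<Delta>'" by (meson finite_subset_image)
  with D show ?case by (blast intro: proves.AllNI)
next
  case (AllSI \<Gamma> p)
  then obtain \<Delta> where D: "finite \<Delta>" "\<Delta> \<subseteq> liftS ` \<Gamma>" "\<Delta> \<turnstile> p" by blast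
  then obtain \<Delta>' where "finite \<Delta>'" "\<Delta>' \<subseteq> \<Gamma>" "\<Delta> = liftS ` \<Delta>'" by (meson finite_subset_image)
  with D show ?case by (blast intro: proves.AllSI)
next
  case (AllNE \<Gamma> p t)
  then show ?case by (blast intro: proves.AllNE)
next
  case (AllSE \<Gamma> p X)
  then show ?case by (blast intro: proves.AllSE)
next
  case (EqRefl \<Gamma> t)
  then show ?case by (blast intro: proves.EqRefl)
next
  case (EqSubst \<Gamma> s t p)
  then obtain \<Delta> \<Delta>' where D: "finite \<Delta>" "\<Delta> \<subseteq> \<Gamma>" "\<Delta> \<turnstile> Eq s t" "finite \<Delta>'" "\<Delta>' \<subseteq> \<Gamma>" "\<Delta>' \<turnstile> instN s p"
    by blast
  have "\<Delta> \<union> \<Delta>' \<turnstile> Eq s t" "\<Delta> \<union> \<Delta>' \<turnstile> instN s p"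
    by (rule weaken[OF D(3)], simp) (rule weaken[OF D(6)], simp)
  then have "\<Delta> \<union> \<Delta>' \<turnstile> instN t p" by (rule proves.EqSubst)
  with D show ?case by (intro exI[of _ "\<Delta> \<union> \<Delta>'"]) auto
qed

lemma subst_instN: "subst \<sigma> \<rho> (instN t p) = instN (subst_tm \<sigma> t) (subst (up \<sigma>) \<rho> p)"
proof -
  have "subst_tm \<sigma> (case k of 0 \<Rightarrow> t | Suc k \<Rightarrow> Var k) = subst_tm (case_nat (subst_tm \<sigma> t) Var) (up \<sigma> k)" for k
    by (cases k) (simp_all add: lift_tm_def subst_tm_comp)
  then show ?thesis by (simp add: instN_def subst_comp)
qed

lemma subst_instS: "subst \<sigma> \<rho> (instS X p) = instS (\<rho> X) (subst \<sigma> (upS \<rho>) p)"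
proof -
  have "\<rho> (case_nat X id k) = case_nat (\<rho> X) id (upS \<rho> k)" for k
    by (cases k) simp_all
  then show ?thesis by (simp add: instS_def subst_comp)
qed

lemma subst_liftN: "subst (up \<sigma>) \<rho> (liftN p) = liftN (subst \<sigma> \<rho> p)"
  by (simp add: liftN_def subst_comp lift_tm_def)

lemma subst_liftS: "subst \<sigma> (upS \<rho>) (liftS p) = liftS (subst \<sigma> \<rho> p)"
  by (simp add: liftS_def subst_comp)

text \<open>
  Derivability is closed under simultaneous substitution in hypotheses and conclusion. This is
  what allows an eigenvariable to be renamed.
\<close>

lemma proves_subst: "\<Gamma> \<turnstile> p \<Longrightarrow> subst \<sigma> \<rho> ` \<Gamma> \<turnstile> subst \<sigma> \<rho> p"
proof (induction arbitrary: \<sigma> \<rho> rule: proves.induct)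
  case (ImpI p \<Gamma> q)
  then show ?case by (auto intro: proves.ImpI)
next
  case (ImpE \<Gamma> p q)
  then show ?case by (metis proves.ImpE subst.simps(5))
next
  case (Contr p \<Gamma>)
  have "insert (Neg (subst \<sigma> \<rho> p)) (subst \<sigma> \<rho> ` \<Gamma>) \<turnstile> Fls" using Contr.IH[of \<sigma> \<rho>] by simp
  then show ?case by (rule proves.Contr)
next
  case (AllNI \<Gamma> p)
  have "liftN ` subst \<sigma> \<rho> ` \<Gamma> \<turnstile> subst (up \<sigma>) \<rho> p"
    using AllNI.IH[of "up \<sigma>" \<rho>] by (simp add: image_image subst_liftN)
  then show ?case by (auto intro: proves.AllNI)
next
  case (AllSI \<Gamma> p)
  have "liftS ` subst \<sigma> \<rho> ` \<Gamma> \<turnstile> subst \<sigma> (upS \<rho>) p"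
    using AllSI.IH[of \<sigma> "upS \<rho>"] by (simp add: image_image subst_liftS)
  then show ?case by (auto intro: proves.AllSI)
next
  case (AllNE \<Gamma> p t)
  then show ?case by (simp add: subst_instN proves.AllNE)
next
  case (AllSE \<Gamma> p X)
  then show ?case by (simp add: subst_instS proves.AllSE)
next
  case (EqSubst \<Gamma> s t p)
  then show ?case
    using proves.EqSubst[OF EqSubst.IH(1)[unfolded subst.simps], of \<sigma> \<rho> "subst (up \<sigma>) \<rho> p"]
    by (simp add: subst_instN)
qed (auto intro: proves.Assm proves.EqRefl)

text \<open>
  Generalization with a named fresh variable instead of lifted hypotheses: the renaming that sends
  the fresh index \<open>k\<close> to 0 and every other index up by one acts on the hypotheses as a lifting and
  undoes the instantiation of \<open>p\<close>.
\<close>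

lemma generalize_number:
  assumes "\<Gamma> \<turnstile> instN (Var k) p" "\<And>q. q \<in> \<Gamma> \<Longrightarrow> k \<notin> fvN q" "Suc k \<notin> fvN p"
  shows "\<Gamma> \<turnstile> AllN p"
proof -
  define \<sigma> where "\<sigma> j = (if j = k then Var 0 else Var (Suc j))" for j
  have "subst \<sigma> id ` \<Gamma> = liftN ` \<Gamma>"
  proof (rule image_cong[OF refl])
    fix q assume "q \<in> \<Gamma>"
    then show "subst \<sigma> id q = liftN q"
      unfolding liftN_def using assms(2) by (intro subst_cong) (auto simp: \<sigma>_def)
  qed
  moreover have "subst \<sigma> id (instN (Var k) p) = p"
  proof -
    have "subst \<sigma> id (instN (Var k) p) = subst Var id p"
      unfolding instN_def subst_comp using assms(3)
      by (intro subst_cong) (auto simp: \<sigma>_def split: nat.split)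
    then show ?thesis by simp
  qed
  ultimately show ?thesis
    using proves_subst[OF assms(1), of \<sigma> id] by (simp add: AllNI)
qed

lemma generalize_set:
  assumes "\<Gamma> \<turnstile> instS k p" "\<And>q. q \<in> \<Gamma> \<Longrightarrow> k \<notin> fvS q" "Suc k \<notin> fvS p"
  shows "\<Gamma> \<turnstile> AllS p"
proof -
  define \<rho> where "\<rho> j = (if j = k then 0 else Suc j)" for j
  have "subst Var \<rho> ` \<Gamma> = liftS ` \<Gamma>"
  proof (rule image_cong[OF refl])
    fix q assume "q \<in> \<Gamma>"
    then show "subst Var \<rho> q = liftS q"
      unfolding liftS_def using assms(2) by (intro subst_cong) (auto simp: \<rho>_def)
  qed
  moreover have "subst Var \<rho> (instS k p) = p"
  proof -
    have "subst Var \<rho> (instS k p) = subst Var id p"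
      unfolding instS_def subst_comp using assms(3)
      by (intro subst_cong) (auto simp: \<rho>_def split: nat.split)
    then show ?thesis by simp
  qed
  ultimately show ?thesis
    using proves_subst[OF assms(1), of Var \<rho>] by (simp add: AllSI)
qed

lemma ImpI_iff: "\<Gamma> \<turnstile> Imp p q \<longleftrightarrow> insert p \<Gamma> \<turnstile> q"
  by (metis Assm ImpE ImpI insertI1 subset_insertI weaken)

lemma ex_falso: "\<Gamma> \<turnstile> Fls \<Longrightarrow> \<Gamma> \<turnstile> p"
  by (meson Contr subset_insertI weaken)

lemma cut: "insert p \<Gamma> \<turnstile> q \<Longrightarrow> \<Gamma> \<turnstile> p \<Longrightarrow> \<Gamma> \<turnstile> q"
  by (meson ImpE ImpI)

lemma Neg_proves: "\<Gamma> \<turnstile> Neg p \<longleftrightarrow> insert p \<Gamma> \<turnstile> Fls"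
  by (simp add: Neg_def ImpI_iff)

section \<open>Henkin completion\<close>

definition witness_number :: "fm set \<Rightarrow> fm \<Rightarrow> nat" where
  "witness_number G p = (SOME k. (\<forall>q\<in>G. k \<notin> fvN q) \<and> Suc k \<notin> fvN p)"

definition witness_set :: "fm set \<Rightarrow> fm \<Rightarrow> nat" where
  "witness_set G p = (SOME k. (\<forall>q\<in>G. k \<notin> fvS q) \<and> Suc k \<notin> fvS p)"

definition witnesses :: "fm set \<Rightarrow> fm \<Rightarrow> fm set" where
  "witnesses G p =
     {Neg (instN (Var (witness_number G q)) q) | q. p = Neg (AllN q)} \<union>
     {Neg (instS (witness_set G q) q) | q. p = Neg (AllS q)}"

text \<open>
  Each formula is added if that keeps the set consistent, and a refuted universal formula brings
  a counterexample named by a variable that has not been used so far.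
\<close>

primrec stage :: "fm set \<Rightarrow> nat \<Rightarrow> fm set" where
  "stage T 0 = T"
| "stage T (Suc n) =
     (if insert (from_nat n) (stage T n) \<turnstile> Fls then stage T n
      else insert (from_nat n) (stage T n) \<union> witnesses (stage T n) (from_nat n))"

definition sentences :: "fm set \<Rightarrow> bool" where
  "sentences T \<longleftrightarrow> (\<forall>q\<in>T. fvN q = {} \<and> fvS q = {})"

text \<open>
  The last two clauses say that terms and set variables already exhaust the two sorts.
\<close>

definition henkin :: "fm set \<Rightarrow> bool" where
  "henkin H \<longleftrightarrow> \<not> H \<turnstile> Fls \<and> (\<forall>p. p \<in> H \<or> Neg p \<in> H) \<and>
     (\<forall>p. (\<forall>t. instN t p \<in> H) \<longrightarrow> AllN p \<in> H) \<and>
     (\<forall>p. (\<forall>X. instS X p \<in> H) \<longrightarrow> AllS p \<in> H)"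

lemma Neg_inj [simp]: "Neg p = Neg q \<longleftrightarrow> p = q"
  by (simp add: Neg_def)

lemma finite_witnesses [simp]: "finite (witnesses G p)"
proof -
  have "witnesses G p \<subseteq> (case p of Imp (AllN q) r \<Rightarrow> {Neg (instN (Var (witness_number G q)) q)}
      | Imp (AllS q) r \<Rightarrow> {Neg (instS (witness_set G q) q)} | _ \<Rightarrow> {})"
    by (auto simp: witnesses_def Neg_def)
  moreover have "finite (case p of Imp (AllN q) r \<Rightarrow> {Neg (instN (Var (witness_number G q)) q)}
      | Imp (AllS q) r \<Rightarrow> {Neg (instS (witness_set G q) q)} | _ \<Rightarrow> {})"
    by (auto split: fm.split)
  ultimately show ?thesis by (rule finite_subset)
qed

lemma stage_Suc_cases:
  "stage T (Suc n) = stage T n \<or>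
   \<not> insert (from_nat n) (stage T n) \<turnstile> Fls \<and>
   stage T (Suc n) = insert (from_nat n) (stage T n) \<union> witnesses (stage T n) (from_nat n)"
  by simp

declare stage.simps(2) [simp del]

lemma stage_finite_extension: "\<exists>F. finite F \<and> stage T n = T \<union> F"
proof (induction n)
  case 0
  show ?case by (rule exI[of _ "{}"]) simp
next
  case (Suc n)
  then obtain F where F: "finite F" "stage T n = T \<union> F" by blast
  consider "stage T (Suc n) = T \<union> F"
    | "stage T (Suc n) = T \<union> (insert (from_nat n) F \<union> witnesses (stage T n) (from_nat n))"
    using stage_Suc_cases[of T n] F(2) by auto
  then show ?case
  proof cases
    case 1
    with F(1) show ?thesis by blast
  next
    case 2
    moreover have "finite (insert (from_nat n) F \<union> witnesses (stage T n) (from_nat n))"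
      using F(1) by simp
    ultimately show ?thesis by blast
  qed
qed

lemma fresh_index:
  assumes "finite F" "\<And>q. q \<in> T \<Longrightarrow> fv q = {}" "\<And>q. finite (fv q)"
  shows "\<exists>k::nat. (\<forall>q\<in>T \<union> F. k \<notin> fv q) \<and> Suc k \<notin> fv p"
proof -
  have "finite (\<Union> (fv ` F) \<union> {k. Suc k \<in> fv p})"
    using assms(1) finite_pred_image[OF assms(3)] assms(3) by simp
  then obtain k where "k \<notin> \<Union> (fv ` F) \<union> {k. Suc k \<in> fv p}"
    using ex_new_if_finite[OF infinite_UNIV_nat] by meson
  then show ?thesis
    using assms(2) by (intro exI[of _ k]) auto
qed

text \<open>
  Sentences use up no free variables, and only finitely many further formulas have been added at
  any stage, so fresh variables never run out.
\<close>

lemma fresh_variables: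
  assumes "sentences T" "finite F"
  shows "\<exists>k. (\<forall>q\<in>T \<union> F. k \<notin> fvN q) \<and> Suc k \<notin> fvN p"
    and "\<exists>k. (\<forall>q\<in>T \<union> F. k \<notin> fvS q) \<and> Suc k \<notin> fvS p"
  using assms(1) by (intro fresh_index[OF assms(2)]; simp add: sentences_def)+

text \<open>
  If the counterexample could be refuted, then generalization on its fresh variable would derive
  the universal formula whose negation has just been added.
\<close>

lemma add_witnesses_consistent:
  assumes "sentences T" "finite F" "\<not> insert p (T \<union> F) \<turnstile> Fls"
  shows "\<not> insert p (T \<union> F) \<union> witnesses (T \<union> F) p \<turnstile> Fls"
proof
  let ?G = "T \<union> F"
  assume contra: "insert p ?G \<union> witnesses ?G p \<turnstile> Fls"
  consider q where "p = Neg (AllN q)" | q where "p = Neg (AllS q)" | "witnesses ?G p = {}"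
    by (auto simp: witnesses_def)
  then show False
  proof cases
    case 1
    define k where "k = witness_number ?G q"
    have k: "(\<forall>r\<in>?G. k \<notin> fvN r) \<and> Suc k \<notin> fvN q"
      unfolding k_def witness_number_def
      by (rule someI_ex) (rule fresh_variables(1)[OF assms(1,2)])
    have "witnesses ?G p = {Neg (instN (Var k) q)}"
      unfolding witnesses_def k_def 1 by (auto simp: Neg_def)
    then have "insert (Neg (instN (Var k) q)) (insert p ?G) \<turnstile> Fls"
      using contra by simp
    then have "insert p ?G \<turnstile> instN (Var k) q"
      by (rule proves.Contr)
    then have "insert p ?G \<turnstile> AllN q"
      by (rule generalize_number[of _ k]) (use k 1 in auto)
    moreover have "insert p ?G \<turnstile> Imp (AllN q) Fls"
      using 1 by (auto intro: proves.Assm simp: Neg_def)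
    ultimately have "insert p ?G \<turnstile> Fls" by (rule proves.ImpE[rotated])
    with assms(3) show False ..
  next
    case 2
    define k where "k = witness_set ?G q"
    have k: "(\<forall>r\<in>?G. k \<notin> fvS r) \<and> Suc k \<notin> fvS q"
      unfolding k_def witness_set_def
      by (rule someI_ex) (rule fresh_variables(2)[OF assms(1,2)])
    have "witnesses ?G p = {Neg (instS k q)}"
      unfolding witnesses_def k_def 2 by (auto simp: Neg_def)
    then have "insert (Neg (instS k q)) (insert p ?G) \<turnstile> Fls"
      using contra by simp
    then have "insert p ?G \<turnstile> instS k q"
      by (rule proves.Contr)
    then have "insert p ?G \<turnstile> AllS q"
      by (rule generalize_set[of _ k]) (use k 2 in auto)
    moreover have "insert p ?G \<turnstile> Imp (AllS q) Fls"
      using 2 by (auto intro: proves.Assm simp: Neg_def)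
    ultimately have "insert p ?G \<turnstile> Fls" by (rule proves.ImpE[rotated])
    with assms(3) show False ..
  next
    case 3
    then show False using contra assms(3) by simp
  qed
qed

lemma stage_consistent:
  assumes "sentences T" "\<not> T \<turnstile> Fls"
  shows "\<not> stage T n \<turnstile> Fls"
proof (induction n)
  case (Suc n)
  obtain F where "finite F" "stage T n = T \<union> F" using stage_finite_extension by blast
  then show ?case
    using Suc stage_Suc_cases[of T n] add_witnesses_consistent[OF assms(1), of F "from_nat n"]
    by auto
qed (simp add: assms(2))

lemma stage_mono: "m \<le> n \<Longrightarrow> stage T m \<subseteq> stage T n"
  by (rule lift_Suc_mono_le[of "stage T"]) (use stage_Suc_cases[of T] in blast)+

lemma henkin_extension:
  assumes "sentences T" "\<not> T \<turnstile> Fls"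
  shows "\<exists>H. T \<subseteq> H \<and> henkin H"
proof -
  define H where "H = (\<Union>n. stage T n)"
  have sub: "T \<subseteq> H" using stage.simps(1)[of T] unfolding H_def by blast
  have con: "\<not> H \<turnstile> Fls"
  proof
    assume "H \<turnstile> Fls"
    then obtain D where D: "finite D" "D \<subseteq> H" "D \<turnstile> Fls" using finite_support by blast
    have "\<exists>n. D \<subseteq> stage T n"
      using D(1,2)
    proof (induction D)
      case (insert x D)
      then obtain m n where "D \<subseteq> stage T n" "x \<in> stage T m" by (auto simp: H_def)
      then have "insert x D \<subseteq> stage T (max m n)"
        using stage_mono[of m "max m n" T] stage_mono[of n "max m n" T] by auto
      then show ?case ..
    qed simp
    then obtain n where "D \<subseteq> stage T n" ..
    from weaken[OF D(3) this] show False using stage_consistent[OF assms] by simp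
  qed
  have stage_sub: "stage T n \<subseteq> H" for n
    unfolding H_def by blast
  have step: "p \<in> H \<and> (\<exists>G. witnesses G p \<subseteq> H)" if "\<not> insert p H \<turnstile> Fls" for p
  proof -
    let ?G = "stage T (to_nat p)"
    have "\<not> insert p ?G \<turnstile> Fls"
      using that weaken[of "insert p ?G" Fls "insert p H"] insert_mono[OF stage_sub] by metis
    then have "insert p ?G \<union> witnesses ?G p = stage T (Suc (to_nat p))"
      by (simp add: stage.simps(2))
    then have "insert p ?G \<union> witnesses ?G p \<subseteq> H" using stage_sub by metis
    then show ?thesis by (intro conjI exI[of _ ?G]) simp_all
  qed
  have max: "p \<in> H \<or> Neg p \<in> H" for p
  proof (rule ccontr)
    assume "\<not> (p \<in> H \<or> Neg p \<in> H)"
    then have 1: "insert p H \<turnstile> Fls" and 2: "insert (Neg p) H \<turnstile> Fls"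
      using step by (meson, meson)
    from proves.Contr[OF 2] have "H \<turnstile> p" .
    with 1 have "H \<turnstile> Fls" by (rule cut)
    with con show False ..
  qed
  have no_both: "\<not> (p \<in> H \<and> Neg p \<in> H)" for p
  proof
    assume "p \<in> H \<and> Neg p \<in> H"
    then have "H \<turnstile> Imp p Fls" "H \<turnstile> p" by (simp_all add: Neg_def proves.Assm)
    then have "H \<turnstile> Fls" by (rule proves.ImpE)
    with con show False ..
  qed
  have not_in: "\<not> insert (Neg p) H \<turnstile> Fls" if "p \<notin> H" for p
    using that max[of p] con by (simp add: insert_absorb)
  have "AllN p \<in> H" if "\<forall>t. instN t p \<in> H" for p
  proof (rule ccontr)
    assume "AllN p \<notin> H"
    then obtain G where "witnesses G (Neg (AllN p)) \<subseteq> H" using step[OF not_in] by blast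
    then have "Neg (instN (Var (witness_number G p)) p) \<in> H" by (auto simp: witnesses_def)
    with that no_both show False by blast
  qed
  moreover have "AllS p \<in> H" if "\<forall>X. instS X p \<in> H" for p
  proof (rule ccontr)
    assume "AllS p \<notin> H"
    then obtain G where "witnesses G (Neg (AllS p)) \<subseteq> H" using step[OF not_in] by blast
    then have "Neg (instS (witness_set G p) p) \<in> H" by (auto simp: witnesses_def)
    with that no_both show False by blast
  qed
  ultimately show ?thesis using sub con max by (auto simp: henkin_def)
qed

lemma henkin_closed:
  assumes "henkin H"
  shows "H \<turnstile> p \<longleftrightarrow> p \<in> H"
proof
  assume "H \<turnstile> p"
  show "p \<in> H"
  proof (rule ccontr)
    assume "p \<notin> H"
    with assms have "Neg p \<in> H" unfolding henkin_def by blast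
    then have "H \<turnstile> Imp p Fls" by (simp add: Neg_def proves.Assm)
    then have "H \<turnstile> Fls" using \<open>H \<turnstile> p\<close> by (rule proves.ImpE)
    with assms show False by (simp add: henkin_def)
  qed
qed (rule proves.Assm)

lemma henkin_Imp:
  assumes "henkin H"
  shows "Imp p q \<in> H \<longleftrightarrow> (p \<in> H \<longrightarrow> q \<in> H)"
proof -
  have "q \<in> H" if "Imp p q \<in> H" "p \<in> H"
    using proves.ImpE[OF proves.Assm[OF that(1)] proves.Assm[OF that(2)]] henkin_closed[OF assms]
    by simp
  moreover have "Imp p q \<in> H" if "q \<in> H"
  proof -
    have "insert p H \<turnstile> q" using that by (intro proves.Assm) simp
    then show ?thesis using ImpI_iff[of H p q] henkin_closed[OF assms] by simp
  qed
  moreover have "Imp p q \<in> H" if "p \<notin> H"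
  proof -
    have "Neg p \<in> H" using that assms unfolding henkin_def by blast
    then have "H \<turnstile> Neg p" by (rule proves.Assm)
    then have "insert p H \<turnstile> q" unfolding Neg_proves by (rule ex_falso)
    then show ?thesis using ImpI_iff[of H p q] henkin_closed[OF assms] by simp
  qed
  ultimately show ?thesis by blast
qed

lemma henkin_Fls: "henkin H \<Longrightarrow> Fls \<notin> H"
  using proves.Assm[of Fls H] by (auto simp: henkin_def)

lemma henkin_AllN:
  assumes "henkin H"
  shows "AllN p \<in> H \<longleftrightarrow> (\<forall>t. instN t p \<in> H)"
proof
  assume "AllN p \<in> H"
  then show "\<forall>t. instN t p \<in> H"
    using proves.AllNE[OF proves.Assm, of p H] henkin_closed[OF assms] by blast
qed (use assms in \<open>simp add: henkin_def\<close>)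

lemma henkin_AllS:
  assumes "henkin H"
  shows "AllS p \<in> H \<longleftrightarrow> (\<forall>X. instS X p \<in> H)"
proof
  assume "AllS p \<in> H"
  then show "\<forall>X. instS X p \<in> H"
    using proves.AllSE[OF proves.Assm, of p H] henkin_closed[OF assms] by blast
qed (use assms in \<open>simp add: henkin_def\<close>)

section \<open>Tarski semantics over an arbitrary ordered structure\<close>

primrec value_in :: "(nat \<Rightarrow> 'a::{zero,one,plus,times}) \<Rightarrow> tm \<Rightarrow> 'a" where
  "value_in e (Var k) = e k"
| "value_in e Zero = 0"
| "value_in e One = 1"
| "value_in e (Add s t) = value_in e s + value_in e t"
| "value_in e (Mul s t) = value_in e s * value_in e t"

primrec holds :: "'a::{zero,one,plus,times,ord} set set \<Rightarrow> (nat \<Rightarrow> 'a) \<Rightarrow> (nat \<Rightarrow> 'a set) \<Rightarrow> fm \<Rightarrow> bool" where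
  "holds S e f (Eq s t) = (value_in e s = value_in e t)"
| "holds S e f (Less s t) = (value_in e s < value_in e t)"
| "holds S e f (Mem t X) = (value_in e t \<in> f X)"
| "holds S e f Fls = False"
| "holds S e f (Imp p q) = (holds S e f p \<longrightarrow> holds S e f q)"
| "holds S e f (AllN p) = (\<forall>n. holds S (case_nat n e) f p)"
| "holds S e f (AllS p) = (\<forall>X\<in>S. holds S e (case_nat X f) p)"

lemma holds_defined [simp]:
  "holds S e f (Neg p) = (\<not> holds S e f p)"
  "holds S e f (Or p q) = (holds S e f p \<or> holds S e f q)"
  "holds S e f (And p q) = (holds S e f p \<and> holds S e f q)"
  "holds S e f (Iff p q) = (holds S e f p \<longleftrightarrow> holds S e f q)"
  "holds S e f (ExN p) = (\<exists>n. holds S (case_nat n e) f p)"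
  "holds S e f (ExS p) = (\<exists>X\<in>S. holds S e (case_nat X f) p)"
  by (auto simp: Neg_def Or_def And_def Iff_def ExN_def ExS_def)

lemma value_in_subst: "value_in e (subst_tm \<sigma> t) = value_in (\<lambda>k. value_in e (\<sigma> k)) t"
  by (induction t) auto

lemma value_in_lift [simp]: "value_in (case_nat n e) (lift_tm t) = value_in e t"
  by (simp add: lift_tm_def value_in_subst)

lemma holds_subst:
  "holds S e f (subst \<sigma> \<rho> p) = holds S (\<lambda>k. value_in e (\<sigma> k)) (\<lambda>k. f (\<rho> k)) p"
proof (induction p arbitrary: e f \<sigma> \<rho>)
  case (AllN p)
  have "(\<lambda>k. value_in (case_nat n e) (up \<sigma> k)) = case_nat n (\<lambda>k. value_in e (\<sigma> k))" for n
    by (rule ext) (simp add: up_def split: nat.split)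
  then show ?case by (simp add: AllN.IH)
next
  case (AllS p)
  have "(\<lambda>k. case_nat X f (upS \<rho> k)) = case_nat X (\<lambda>k. f (\<rho> k))" for X
    by (rule ext) (simp add: upS_def split: nat.split)
  then show ?case by (simp add: AllS.IH)
qed (auto simp: value_in_subst)

text \<open>
  Shifting an assignment frees the indices that the outer quantifiers bind; instantiating the
  quantifiers with the values of the original assignment restores it.
\<close>

lemma holds_univ_closure:
  assumes "q \<in> univ_closures p" "\<And>e f. range f \<subseteq> S \<Longrightarrow> holds S e f q" "range f \<subseteq> S"
  shows "holds S e f p"
proof -
  obtain m n where q: "q = (AllN ^^ m) ((AllS ^^ n) p)"
    using assms(1) by (auto simp: univ_closures_def)
  have N: "holds S (\<lambda>k. e (k + m)) f ((AllN ^^ m) r) \<Longrightarrow> holds S e f r" for m r and e :: "nat \<Rightarrow> 'a" and f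
  proof (induction m arbitrary: e)
    case (Suc m)
    have "case_nat (e m) (\<lambda>k. e (k + Suc m)) = (\<lambda>k. e (k + m))"
      by (rule ext) (simp split: nat.split)
    with Suc.prems have "holds S (\<lambda>k. e (k + m)) f ((AllN ^^ m) r)"
      by (simp, metis)
    then show ?case by (rule Suc.IH)
  qed simp
  have S: "holds S e (\<lambda>k. f (k + n)) ((AllS ^^ n) r) \<Longrightarrow> range f \<subseteq> S \<Longrightarrow> holds S e f r"
    for n r and e :: "nat \<Rightarrow> 'a" and f
  proof (induction n arbitrary: f)
    case (Suc n)
    have "case_nat (f n) (\<lambda>k. f (k + Suc n)) = (\<lambda>k. f (k + n))"
      by (rule ext) (simp split: nat.split)
    moreover have "f n \<in> S" using Suc.prems(2) by auto
    ultimately have "holds S e (\<lambda>k. f (k + n)) ((AllS ^^ n) r)"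
      using Suc.prems(1) by (simp, metis)
    then show ?case using Suc.prems(2) by (rule Suc.IH)
  qed simp
  have "range (\<lambda>k. f (k + n)) \<subseteq> S" using assms(3) by auto
  then have "holds S (\<lambda>k. e (k + m)) (\<lambda>k. f (k + n)) q" by (rule assms(2))
  then show ?thesis unfolding q using N S assms(3) by blast
qed

section \<open>The term model\<close>

text \<open>
  The negated sentence is added only if it is unprovable. This makes the theory consistent in any
  case, so that the term model can be introduced as a type without a hypothesis.
\<close>

definition base_theory :: "fm set" where
  "base_theory = ACA0 \<union> {q. q = Neg rival_sands_fm \<and> \<not> ACA0 \<turnstile> rival_sands_fm}"

lemma fv_allN_pow: "fvN p \<subseteq> {..<m} \<Longrightarrow> fvN ((AllN ^^ m) p) = {}"
proof (induction m arbitrary: p)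
  case (Suc m)
  have "fvN (AllN p) \<subseteq> {..<m}" using Suc.prems by auto
  from Suc.IH[OF this] show ?case by (simp only: funpow_Suc_right comp_apply)
qed auto

lemma fv_allS_pow: "fvS p \<subseteq> {..<n} \<Longrightarrow> fvS ((AllS ^^ n) p) = {}"
proof (induction n arbitrary: p)
  case (Suc n)
  have "fvS (AllS p) \<subseteq> {..<n}" using Suc.prems by auto
  from Suc.IH[OF this] show ?case by (simp only: funpow_Suc_right comp_apply)
qed auto

lemma fv_pow [simp]: "fvS ((AllN ^^ m) p) = fvS p" "fvN ((AllS ^^ m) p) = fvN p"
  by (induction m) auto

lemma univ_closures_closed: "q \<in> univ_closures p \<Longrightarrow> fvN q = {} \<and> fvS q = {}"
  by (auto simp: univ_closures_def fv_allN_pow fv_allS_pow)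

lemma univ_closures_nonempty: "\<exists>q. q \<in> univ_closures p"
proof -
  have "\<exists>m. A \<subseteq> {..<m}" if "finite A" for A :: "nat set"
    using finite_nat_set_iff_bounded[of A] that by (auto simp: subset_iff)
  then obtain m n where "fvN p \<subseteq> {..<m}" "fvS p \<subseteq> {..<n}"
    using finite_fv by meson
  then show ?thesis unfolding univ_closures_def by blast
qed

lemma fv_rival_sands: "fvN rival_sands_fm = {}" "fvS rival_sands_fm = {}"
  unfolding rival_sands_fm_def zero_inf_homogeneous_fm_def antichain_fm_def chain_fm_def
    partial_order_fm_def infinite_fm_def subset_fm_def comparable_def le_in_def lt_in_def pair_def
    fv_defined fvN.simps fvS.simps fv_tm.simps numeral_2_eq_2 One_nat_def
  by (simp_all add: set_eq_iff)

lemma sentences_base_theory: "sentences base_theory"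
proof -
  have "fvN q = {} \<and> fvS q = {}" if "q \<in> ACA0" for q
    using that unfolding ACA0_def RCA0_def
    by (elim UnE UN_E) (rule univ_closures_closed, assumption)+
  then show ?thesis
    using fv_rival_sands
    unfolding sentences_def base_theory_def Ball_def Un_iff mem_Collect_eq by auto
qed

lemma base_theory_consistent: "\<not> base_theory \<turnstile> Fls"
proof (cases "ACA0 \<turnstile> rival_sands_fm")
  case True
  then have "base_theory = ACA0" by (simp add: base_theory_def)
  then show ?thesis using ACA0_consistent by simp
next
  case False
  then have "base_theory = insert (Neg rival_sands_fm) ACA0" by (auto simp: base_theory_def)
  then show ?thesis using False proves.Contr by auto
qed

definition completion :: "fm set" where
  "completion = (SOME H. base_theory \<subseteq> H \<and> henkin H)"

lemma completion: "base_theory \<subseteq> completion" "henkin completion"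
  using someI_ex[OF henkin_extension[OF sentences_base_theory base_theory_consistent]]
  by (simp_all add: completion_def)

abbreviation equal_terms :: "tm \<Rightarrow> tm \<Rightarrow> bool" (infix "\<approx>" 50) where
  "s \<approx> t \<equiv> Eq s t \<in> completion"

lemma equal_terms_subst: "s \<approx> t \<Longrightarrow> instN s p \<in> completion \<Longrightarrow> instN t p \<in> completion"
  using proves.EqSubst[of completion s t p] henkin_closed[OF completion(2)] by simp

lemma subst_lift_tm [simp]: "subst_tm (case_nat t Var) (lift_tm s) = s"
  by (simp add: lift_tm_def subst_tm_comp)

lemma equal_terms_refl: "t \<approx> t"
  using proves.EqRefl[of completion t] henkin_closed[OF completion(2)] by simp

lemma equal_terms_sym: "s \<approx> t \<Longrightarrow> t \<approx> s"
  using equal_terms_subst[of s t "Eq (Var 0) (lift_tm s)"] by (simp add: instN_def equal_terms_refl)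

lemma equal_terms_trans: "s \<approx> t \<Longrightarrow> t \<approx> u \<Longrightarrow> s \<approx> u"
  using equal_terms_subst[of t u "Eq (lift_tm s) (Var 0)"] by (simp add: instN_def)

quotient_type elt = tm / "\<lambda>s t. s \<approx> t"
  by (rule equivpI)
     (auto intro!: reflpI sympI transpI equal_terms_refl intro: equal_terms_sym equal_terms_trans)

lemma equal_Add: "s \<approx> s' \<Longrightarrow> t \<approx> t' \<Longrightarrow> Add s t \<approx> Add s' t'"
  using equal_terms_subst[of s s' "Eq (Add (lift_tm s) (lift_tm t)) (Add (Var 0) (lift_tm t))"]
    equal_terms_subst[of t t' "Eq (Add (lift_tm s) (lift_tm t)) (Add (lift_tm s') (Var 0))"]
  by (simp add: instN_def equal_terms_refl)

lemma equal_Mul: "s \<approx> s' \<Longrightarrow> t \<approx> t' \<Longrightarrow> Mul s t \<approx> Mul s' t'"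
  using equal_terms_subst[of s s' "Eq (Mul (lift_tm s) (lift_tm t)) (Mul (Var 0) (lift_tm t))"]
    equal_terms_subst[of t t' "Eq (Mul (lift_tm s) (lift_tm t)) (Mul (lift_tm s') (Var 0))"]
  by (simp add: instN_def equal_terms_refl)

lemma equal_Less: "s \<approx> s' \<Longrightarrow> t \<approx> t' \<Longrightarrow> Less s t \<in> completion \<longleftrightarrow> Less s' t' \<in> completion"
proof -
  have "Less s' t' \<in> completion" if "s \<approx> s'" "t \<approx> t'" "Less s t \<in> completion" for s t s' t'
    using equal_terms_subst[OF that(1), of "Less (Var 0) (lift_tm t)"]
      equal_terms_subst[OF that(2), of "Less (lift_tm s') (Var 0)"] that(3)
    by (simp add: instN_def)
  then show "s \<approx> s' \<Longrightarrow> t \<approx> t' \<Longrightarrow> ?thesis" by (meson equal_terms_sym)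
qed

lemma equal_Mem: "s \<approx> t \<Longrightarrow> Mem s X \<in> completion \<Longrightarrow> Mem t X \<in> completion"
  using equal_terms_subst[of s t "Mem (Var 0) X"] by (simp add: instN_def)

instantiation elt :: "{zero,one,plus,times,ord}"
begin

lift_definition zero_elt :: elt is Zero .
lift_definition one_elt :: elt is One .
lift_definition plus_elt :: "elt \<Rightarrow> elt \<Rightarrow> elt" is Add by (rule equal_Add)
lift_definition times_elt :: "elt \<Rightarrow> elt \<Rightarrow> elt" is Mul by (rule equal_Mul)
lift_definition less_elt :: "elt \<Rightarrow> elt \<Rightarrow> bool" is "\<lambda>s t. Less s t \<in> completion"
  by (rule equal_Less)

definition less_eq_elt :: "elt \<Rightarrow> elt \<Rightarrow> bool" where "less_eq_elt x y \<longleftrightarrow> x < y \<or> x = y"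

instance ..

end

definition extension :: "nat \<Rightarrow> elt set" where
  "extension X = abs_elt ` {t. Mem t X \<in> completion}"

lemma abs_elt_eq_iff: "abs_elt s = abs_elt t \<longleftrightarrow> s \<approx> t"
  using Quotient_rel_abs[OF Quotient_elt] by (simp add: elt.abs_eq_iff)

lemma abs_elt_in_extension: "abs_elt t \<in> extension X \<longleftrightarrow> Mem t X \<in> completion"
proof
  assume "abs_elt t \<in> extension X"
  then obtain s where "t \<approx> s" "Mem s X \<in> completion"
    by (auto simp: extension_def abs_elt_eq_iff)
  then show "Mem t X \<in> completion" using equal_Mem equal_terms_sym by metis
qed (simp add: extension_def)

lemma value_in_terms: "value_in (\<lambda>k. abs_elt (\<sigma> k)) t = abs_elt (subst_tm \<sigma> t)"
  by (induction t) (simp_all add: zero_elt.abs_eq one_elt.abs_eq plus_elt.abs_eq times_elt.abs_eq)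

lemma abs_elt_surj: "\<exists>t. abs_elt t = x"
  by (metis Quotient_abs_rep[OF Quotient_elt])

text \<open>
  The truth lemma. By substitution it covers formulas with free variables, which the induction
  needs at the quantifiers; there the Henkin property turns truth for all elements into membership
  of all instances.
\<close>

lemma term_model_truth:
  "holds (range extension) (\<lambda>k. abs_elt (\<sigma> k)) (\<lambda>k. extension (\<rho> k)) p \<longleftrightarrow> subst \<sigma> \<rho> p \<in> completion"
proof (induction p arbitrary: \<sigma> \<rho>)
  case (AllN p)
  have eq: "case_nat (abs_elt t) (\<lambda>k. abs_elt (\<sigma> k)) = (\<lambda>k. abs_elt (case_nat t \<sigma> k))" for t
    by (rule ext) (simp split: nat.split)
  have inst: "instN t (subst (up \<sigma>) \<rho> p) = subst (case_nat t \<sigma>) \<rho> p" for t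
  proof -
    have "(\<lambda>k. subst_tm (case_nat t Var) (up \<sigma> k)) = case_nat t \<sigma>"
      by (rule ext) (simp add: up_def split: nat.split)
    then show ?thesis by (simp add: instN_def subst_comp)
  qed
  have "holds (range extension) (\<lambda>k. abs_elt (\<sigma> k)) (\<lambda>k. extension (\<rho> k)) (AllN p) \<longleftrightarrow>
      (\<forall>t. holds (range extension) (case_nat (abs_elt t) (\<lambda>k. abs_elt (\<sigma> k))) (\<lambda>k. extension (\<rho> k)) p)"
    by (metis abs_elt_surj holds.simps(6))
  also have "\<dots> \<longleftrightarrow> (\<forall>t. subst (case_nat t \<sigma>) \<rho> p \<in> completion)"
    unfolding eq AllN.IH ..
  finally show ?case
    by (simp add: henkin_AllN[OF completion(2)] inst)
next
  case (AllS p)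
  have eq: "case_nat (extension X) (\<lambda>k. extension (\<rho> k)) = (\<lambda>k. extension (case_nat X \<rho> k))" for X
    by (rule ext) (simp split: nat.split)
  have inst: "instS X (subst \<sigma> (upS \<rho>) p) = subst \<sigma> (case_nat X \<rho>) p" for X
  proof -
    have "(\<lambda>k. case_nat X id (upS \<rho> k)) = case_nat X \<rho>"
      by (rule ext) (simp add: upS_def split: nat.split)
    then show ?thesis by (simp add: instS_def subst_comp)
  qed
  have "holds (range extension) (\<lambda>k. abs_elt (\<sigma> k)) (\<lambda>k. extension (\<rho> k)) (AllS p) \<longleftrightarrow>
      (\<forall>X. subst \<sigma> (case_nat X \<rho>) p \<in> completion)"
    by (simp add: eq AllS.IH)
  then show ?case
    by (simp add: henkin_AllS[OF completion(2)] inst)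
qed (simp_all add: value_in_terms abs_elt_eq_iff less_elt.abs_eq abs_elt_in_extension
      henkin_Imp[OF completion(2)] henkin_Fls[OF completion(2)])

lemma term_model_assignment:
  assumes "range f \<subseteq> range extension"
  shows "\<exists>\<sigma> \<rho>. e = (\<lambda>k. abs_elt (\<sigma> k)) \<and> f = (\<lambda>k. extension (\<rho> k))"
proof -
  have "\<forall>k. \<exists>t. e k = abs_elt t" using abs_elt_surj by metis
  moreover have "\<forall>k. \<exists>X. f k = extension X" using assms by blast
  ultimately show ?thesis by metis
qed

lemma term_model_sentence:
  assumes "fvN p = {}" "fvS p = {}" "range f \<subseteq> range extension"
  shows "holds (range extension) e f p \<longleftrightarrow> p \<in> completion"
proof -
  obtain \<sigma> \<rho> where "e = (\<lambda>k. abs_elt (\<sigma> k))" "f = (\<lambda>k. extension (\<rho> k))"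
    using term_model_assignment[OF assms(3)] by blast
  then show ?thesis using term_model_truth[of \<sigma> \<rho> p] subst_closed[OF assms(1,2)] by simp
qed

lemma term_model_axiom:
  assumes "univ_closures p \<subseteq> ACA0" "range f \<subseteq> range extension"
  shows "holds (range extension) e f p"
proof -
  obtain q where q: "q \<in> univ_closures p" using univ_closures_nonempty by blast
  then have "q \<in> completion" using assms(1) completion(1) by (auto simp: base_theory_def)
  then show ?thesis
    using holds_univ_closure[OF q _ assms(2)] term_model_sentence univ_closures_closed[OF q] by blast
qed


lemma term_model_semiring_axioms:
  "\<forall>p\<in>semiring_axioms. holds (range extension) e (\<lambda>_. extension 0) p"
  by (intro ballI term_model_axiom) (auto simp: ACA0_def RCA0_def)

lemma term_model_semiring:
  fixes x y z :: elt
  shows "x + y + z = x + (y + z)" and "x + y = y + x"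
    and "x * y * z = x * (y * z)" and "x * y = y * x" and "x * (y + z) = x * y + x * z"
    and "x + 0 = x" and "x * 0 = 0" and "x * 1 = x"
    and "x < y \<Longrightarrow> y < z \<Longrightarrow> x < z" and "\<not> x < x" and "x < y \<or> x = y \<or> y < x"
    and "x < y \<Longrightarrow> x + z < y + z" and "0 < z \<Longrightarrow> x < y \<Longrightarrow> x * z < y * z"
    and "x < y \<Longrightarrow> \<exists>w. x + w = y" and "(0::elt) < 1" and "0 < x \<Longrightarrow> 1 < x \<or> 1 = x"
    and "0 < x \<or> 0 = x"
  using term_model_semiring_axioms[of "case_nat x (case_nat y (case_nat z (\<lambda>_. 0)))"]
  unfolding semiring_axioms_def Let_def ball_simps holds.simps holds_defined value_in.simps
    value_in_lift numeral_2_eq_2 One_nat_def nat.case by iprover+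

instantiation elt :: linordered_semidom
begin

text \<open>
  The class \<open>linordered_semidom\<close>, which provides the usual algebra of ordered semirings, asks for
  a subtraction; the truncated one satisfies its laws.
\<close>

definition minus_elt :: "elt \<Rightarrow> elt \<Rightarrow> elt" where
  "minus_elt x y = (if y \<le> x then SOME w. y + w = x else 0)"

lemma elt_add_cancel: "(x::elt) + y = x + z \<longleftrightarrow> y = z"
  using term_model_semiring(2,10,11,12) by metis

lemma elt_diff: "(y::elt) + w - y = w"
proof -
  have "y \<le> y + w"
    using term_model_semiring(2,6,12,17) unfolding less_eq_elt_def by metis
  moreover have "(SOME v. y + v = y + w) = w"
    by (rule some_equality) (simp_all add: elt_add_cancel)
  ultimately show ?thesis by (simp add: minus_elt_def)
qed

lemma elt_le_iff: "(x::elt) \<le> y \<longleftrightarrow> (\<exists>w. y = x + w)"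
  using term_model_semiring(2,6,12,14,17) unfolding less_eq_elt_def by metis

lemma elt_not_le: "\<not> (x::elt) \<le> y \<longleftrightarrow> y < x"
  using term_model_semiring(9,10,11) unfolding less_eq_elt_def by metis

lemma elt_diff_zero: "(y::elt) \<le> x \<Longrightarrow> y - x = 0"
proof (cases "x \<le> y")
  case True
  assume "y \<le> x"
  with True have "x = y" using term_model_semiring(9,10) unfolding less_eq_elt_def by metis
  then show ?thesis using elt_diff[of y 0] by (simp add: term_model_semiring(6))
qed (simp add: minus_elt_def)

instance
proof
  fix a b c :: elt
  note ax = term_model_semiring
  show "a + b + c = a + (b + c)" "a + b = b + a" "a * b * c = a * (b * c)" "a * b = b * a" by (rule ax)+
  show "0 + a = a" using ax(2,6) by metis
  show "a + b - a = b" by (rule elt_diff)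
  show "(0::elt) \<noteq> 1" using ax(10,15) by metis
  show "1 * a = a" using ax(4,8) by metis
  show "0 * a = 0" "a * 0 = 0" using ax(4,7) by metis+
  show "a * (b + c) = a * b + a * c" by (rule ax)
  show "(a + b) * c = a * c + b * c" using ax(4,5) by metis
  show "a \<le> a" "a \<le> b \<or> b \<le> a" "(a < b) = (a \<le> b \<and> \<not> b \<le> a)"
    using ax(9,10,11) unfolding less_eq_elt_def by metis+
  show "a \<le> b \<Longrightarrow> b \<le> c \<Longrightarrow> a \<le> c" "a \<le> b \<Longrightarrow> b \<le> a \<Longrightarrow> a = b"
    using ax(9,10) unfolding less_eq_elt_def by metis+
  show "a \<le> b \<Longrightarrow> c + a \<le> c + b"
    using ax(2,12) unfolding less_eq_elt_def by metis
  show "a < b \<Longrightarrow> 0 < c \<Longrightarrow> c * a < c * b" using ax(4,13) by metis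
  show "(0::elt) < 1" by (rule ax)
  show "b \<le> a \<Longrightarrow> a - b + b = a"
    using elt_le_iff[of b a] elt_diff[of b] ax(2) by metis
  show "a - b - c = a - (b + c)"
  proof (cases "b \<le> a")
    case True
    then obtain w where w: "a = b + w" by (auto simp: elt_le_iff)
    show ?thesis
    proof (cases "c \<le> w")
      case True
      then obtain v where "w = c + v" by (auto simp: elt_le_iff)
      then have "a = (b + c) + v" using w ax(1) by simp
      then show ?thesis using w \<open>w = c + v\<close> by (simp only: elt_diff) (metis ax(1) elt_diff)
    next
      case False
      then have "w < c" by (simp add: elt_not_le)
      then have "a < b + c" using w ax(2,12) by metis
      then have "a - (b + c) = 0" "w - c = 0"
        using \<open>w < c\<close> by (auto intro!: elt_diff_zero simp: less_eq_elt_def)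
      then show ?thesis using w by (simp add: elt_diff)
    qed
  next
    case False
    then have "a < b" by (simp add: elt_not_le)
    then have "a \<le> b + c" using ax(9) elt_le_iff[of b "b + c"] unfolding less_eq_elt_def by metis
    moreover have "(0::elt) \<le> c" using ax(17)[of c] by (auto simp: less_eq_elt_def)
    moreover have "a - b = 0" using \<open>a < b\<close> by (intro elt_diff_zero) (simp add: less_eq_elt_def)
    ultimately show ?thesis by (simp add: elt_diff_zero)
  qed
  show "a * (b - c) = a * b - a * c"
  proof (cases "c \<le> b")
    case True
    then obtain w where "b = c + w" by (auto simp: elt_le_iff)
    then show ?thesis by (simp add: elt_diff ax(5))
  next
    case False
    then have "b < c" by (simp add: elt_not_le)
    then obtain w where "c = b + w" using ax(14) by metis
    then have "a * b \<le> a * c" by (auto simp: elt_le_iff ax(5))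
    moreover have "b - c = 0" using \<open>b < c\<close> by (intro elt_diff_zero) (simp add: less_eq_elt_def)
    ultimately show ?thesis by (simp add: elt_diff_zero ax(7))
  qed
  show "a \<noteq> 0 \<Longrightarrow> b \<noteq> 0 \<Longrightarrow> a * b \<noteq> 0"
    using ax(4,7,10,13,17) by metis
qed

end

section \<open>Arithmetically definable relations\<close>

text \<open>
  What remains of a model of \<open>ACA0\<close>: the numbers are the elements of a type, and \<open>S\<close> is the family
  of sets. Formulas occur only in the comprehension assumption.
\<close>

locale aca_structure =
  fixes S :: "'a::linordered_semidom set set"
  assumes nonneg: "0 \<le> (x::'a)"
    and discrete: "0 < (x::'a) \<Longrightarrow> 1 \<le> x"
    and set_induct: "X \<in> S \<Longrightarrow> 0 \<in> X \<Longrightarrow> (\<And>x. x \<in> X \<Longrightarrow> x + 1 \<in> X) \<Longrightarrow> x \<in> X"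
    and comprehension:
      "arithmetical p \<Longrightarrow> range f \<subseteq> S \<Longrightarrow> {x. holds S (case_nat x e) f p} \<in> S"
    and inhabited: "S \<noteq> {}"
begin

text \<open>
  Predicates on assignments that an arithmetical formula with parameters from \<open>S\<close> defines. The
  closure rules below have the form of higher-order patterns, so that \<open>intro\<close> proves the
  arithmeticity of a concrete predicate by following its syntax: a quantifier moves the other
  variables \<open>e n\<close> to \<open>e (Suc n)\<close> and calls its own variable \<open>e 0\<close>.
\<close>

definition arith :: "((nat \<Rightarrow> 'a) \<Rightarrow> bool) \<Rightarrow> bool" where
  "arith Q \<longleftrightarrow> (\<exists>p f. arithmetical p \<and> range f \<subseteq> S \<and> (\<forall>e. Q e = holds S e f p))"

lemma arithI: "arithmetical p \<Longrightarrow> range f \<subseteq> S \<Longrightarrow> (\<And>e. Q e = holds S e f p) \<Longrightarrow> arith Q"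
  unfolding arith_def by blast

lemma arithmetical_subst [simp]: "arithmetical (subst \<sigma> \<rho> p) = arithmetical p"
  by (induction p arbitrary: \<sigma> \<rho>) auto

lemma arith_pure: "arithmetical p \<Longrightarrow> (\<And>e f. Q e = holds S e f p) \<Longrightarrow> arith Q"
proof -
  obtain X where "X \<in> S" using inhabited by blast
  then show "arithmetical p \<Longrightarrow> (\<And>e f. Q e = holds S e f p) \<Longrightarrow> arith Q"
    by (intro arithI[of p "\<lambda>_. X"]) auto
qed

lemma arith_rename: "arith Q \<Longrightarrow> arith (\<lambda>e. Q (\<lambda>n. e (\<pi> n)))"
proof -
  assume "arith Q"
  then obtain p f where "arithmetical p" "range f \<subseteq> S" "\<And>e. Q e = holds S e f p"
    unfolding arith_def by blast
  then show ?thesis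
    by (intro arithI[of "subst (\<lambda>k. Var (\<pi> k)) (\<lambda>k. k) p" f]) (simp_all add: holds_subst)
qed

text \<open>
  The two formulas may use different set parameters, so these are interleaved on the even and the
  odd indices.
\<close>

lemma arith_imp:
  assumes "arith Q" "arith R"
  shows "arith (\<lambda>e. Q e \<longrightarrow> R e)"
proof -
  obtain p f where p: "arithmetical p" "range f \<subseteq> S" "\<And>e. Q e = holds S e f p"
    using assms(1) unfolding arith_def by blast
  obtain q g where q: "arithmetical q" "range g \<subseteq> S" "\<And>e. R e = holds S e g q"
    using assms(2) unfolding arith_def by blast
  define h where "h k = (if even k then f (k div 2) else g (k div 2))" for k
  have "range h \<subseteq> S" using p(2) q(2) by (auto simp: h_def)
  moreover have "(\<lambda>k. h (2 * k)) = f" "(\<lambda>k. h (2 * k + 1)) = g"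
    by (auto simp: h_def)
  ultimately show ?thesis
    using p(1,3) q(1,3)
    by (intro arithI[of "Imp (subst Var (\<lambda>k. 2 * k) p) (subst Var (\<lambda>k. 2 * k + 1) q)" h])
       (simp_all add: holds_subst)
qed

lemma arith_False: "arith (\<lambda>e. False)"
  by (rule arith_pure[of Fls]) simp_all

lemma arith_not: "arith Q \<Longrightarrow> arith (\<lambda>e. \<not> Q e)"
  using arith_imp[OF _ arith_False] by simp

lemma arith_disj: "arith Q \<Longrightarrow> arith R \<Longrightarrow> arith (\<lambda>e. Q e \<or> R e)"
  using arith_imp[OF arith_not[of Q], of R] by (simp add: disj_imp)

lemma arith_conj: "arith Q \<Longrightarrow> arith R \<Longrightarrow> arith (\<lambda>e. Q e \<and> R e)"
  using arith_not[OF arith_imp[OF _ arith_not], of Q R] by simp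

lemma arith_iff: "arith Q \<Longrightarrow> arith R \<Longrightarrow> arith (\<lambda>e. Q e \<longleftrightarrow> R e)"
  using arith_conj[OF arith_imp[of Q R] arith_imp[of R Q]] by (simp add: iff_conv_conj_imp)

lemma arith_all: "arith (\<lambda>e. Q (e 0) (\<lambda>n. e (Suc n))) \<Longrightarrow> arith (\<lambda>e. \<forall>x. Q x e)"
proof -
  assume "arith (\<lambda>e. Q (e 0) (\<lambda>n. e (Suc n)))"
  then obtain p f where pf: "arithmetical p" "range f \<subseteq> S"
    and eq: "\<And>e. Q (e 0) (\<lambda>n. e (Suc n)) = holds S e f p"
    unfolding arith_def by blast
  have "Q x e = holds S (case_nat x e) f p" for x e
    using eq[of "case_nat x e"] by simp
  with pf show ?thesis by (intro arithI[of "AllN p" f]) simp_all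
qed

lemma arith_ex: "arith (\<lambda>e. Q (e 0) (\<lambda>n. e (Suc n))) \<Longrightarrow> arith (\<lambda>e. \<exists>x. Q x e)"
  using arith_not[OF arith_all[of "\<lambda>x e. \<not> Q x e"]] arith_not by simp

lemma arith_ball:
  "arith (\<lambda>e. e 0 \<in> X (\<lambda>n. e (Suc n)) \<longrightarrow> Q (e 0) (\<lambda>n. e (Suc n))) \<Longrightarrow> arith (\<lambda>e. \<forall>x\<in>X e. Q x e)"
  unfolding Ball_def by (rule arith_all)

lemma arith_bex:
  "arith (\<lambda>e. e 0 \<in> X (\<lambda>n. e (Suc n)) \<and> Q (e 0) (\<lambda>n. e (Suc n))) \<Longrightarrow> arith (\<lambda>e. \<exists>x\<in>X e. Q x e)"
  unfolding Bex_def by (rule arith_ex)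

text \<open>
  Functions of an assignment whose graph is arithmetical; they may be nested freely inside
  arithmetical predicates, which is the role of terms in formulas.
\<close>

definition fn :: "((nat \<Rightarrow> 'a) \<Rightarrow> 'a) \<Rightarrow> bool" where
  "fn T \<longleftrightarrow> arith (\<lambda>e. e 0 = T (\<lambda>n. e (Suc n)))"

lemma fn_rename: "fn T \<Longrightarrow> fn (\<lambda>e. T (\<lambda>n. e (\<pi> n)))"
  unfolding fn_def using arith_rename[of _ "case_nat 0 (\<lambda>n. Suc (\<pi> n))"] by force

lemma fn_var: "fn (\<lambda>e. e n)"
  unfolding fn_def by (rule arith_pure[of "Eq (Var 0) (Var (Suc n))"]) simp_all

lemma singleton_in_S: "{c} \<in> S"
proof -
  obtain X where "X \<in> S" using inhabited by blast
  then have "{x. holds S (case_nat x (\<lambda>_. c)) (\<lambda>_. X) (Eq (Var 0) (Var 1))} \<in> S"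
    by (intro comprehension) auto
  then show ?thesis by simp
qed

text \<open>
  A number parameter is brought in through its singleton, so that parameters of one sort suffice
  in the definition of \<open>arith\<close>.
\<close>

lemma fn_const: "fn (\<lambda>e. c)"
  unfolding fn_def
  by (rule arithI[of "Mem (Var 0) 0" "\<lambda>_. {c}"]) (auto simp: singleton_in_S)

abbreviation rel1 where "rel1 R \<equiv> arith (\<lambda>e. R (e 0))"
abbreviation rel2 where "rel2 R \<equiv> arith (\<lambda>e. R (e 0) (e 1))"
abbreviation rel3 where "rel3 R \<equiv> arith (\<lambda>e. R (e 0) (e 1) (e 2))"
abbreviation fun1 where "fun1 h \<equiv> fn (\<lambda>e. h (e 0))"
abbreviation fun2 where "fun2 h \<equiv> fn (\<lambda>e. h (e 0) (e 1))"

text \<open>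
  Substitution of a definable function, by quantifying over its value.
\<close>

lemma arith_let:
  assumes "fn t" "arith (\<lambda>e. Q (e 0) (\<lambda>n. e (Suc n)))"
  shows "arith (\<lambda>e. Q (t e) e)"
proof -
  have "arith (\<lambda>e. \<exists>x. x = t e \<and> Q x e)"
    by (intro arith_ex arith_conj assms(2) assms(1)[unfolded fn_def])
  then show ?thesis by simp
qed

lemma rel1_app: "rel1 R \<Longrightarrow> fn t \<Longrightarrow> arith (\<lambda>e. R (t e))"
  by (rule arith_let)

lemma rel2_app: 
  assumes "rel2 R" "fn s" "fn t"
  shows "arith (\<lambda>e. R (s e) (t e))"
proof (rule arith_let[OF assms(2)], rule arith_let[OF fn_rename[OF assms(3)]])
  show "arith (\<lambda>e. R (e (Suc 0)) (e 0))"
    using arith_rename[OF assms(1), of "\<lambda>n. 1 - n"] by simp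
qed

lemma rel3_app: 
  assumes "rel3 R" "fn s" "fn t" "fn u"
  shows "arith (\<lambda>e. R (s e) (t e) (u e))"
proof (rule arith_let[OF assms(2)], rule arith_let[OF fn_rename[OF assms(3)]],
    rule arith_let[OF fn_rename[OF fn_rename[OF assms(4)]]])
  show "arith (\<lambda>e. R (e (Suc (Suc 0))) (e (Suc 0)) (e 0))"
    using arith_rename[OF assms(1), of "\<lambda>n. 2 - n"] by (simp add: numeral_2_eq_2)
qed

lemma fnI: "arith (\<lambda>e. e 0 = T (\<lambda>n. e (Suc n))) \<Longrightarrow> fn T"
  by (simp add: fn_def)

lemma arith_eq: "fn s \<Longrightarrow> fn t \<Longrightarrow> arith (\<lambda>e. s e = t e)"
  by (rule rel2_app) (rule arith_pure[of "Eq (Var 0) (Var 1)"], simp_all)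

lemma arith_less: "fn s \<Longrightarrow> fn t \<Longrightarrow> arith (\<lambda>e. s e < t e)"
  by (rule rel2_app) (rule arith_pure[of "Less (Var 0) (Var 1)"], simp_all)

lemma arith_le: "fn s \<Longrightarrow> fn t \<Longrightarrow> arith (\<lambda>e. s e \<le> t e)"
  unfolding not_less[symmetric] by (intro arith_not arith_less)

lemma arith_mem: "X \<in> S \<Longrightarrow> fn t \<Longrightarrow> arith (\<lambda>e. t e \<in> X)"
  by (rule rel1_app) (rule arithI[of "Mem (Var 0) 0" "\<lambda>_. X"], auto)

lemma fun1_app: "fun1 h \<Longrightarrow> fn t \<Longrightarrow> fn (\<lambda>e. h (t e))"
proof (rule fnI)
  assume h: "fun1 h" and t: "fn t"
  have "arith (\<lambda>e. e 1 = h (e 0))"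
    using arith_rename[OF h[unfolded fn_def], of "\<lambda>n. 1 - n"] by simp
  from rel2_app[of "\<lambda>x y. y = h x", OF this fn_rename[OF t] fn_var[of 0]]
  show "arith (\<lambda>e. e 0 = h (t (\<lambda>n. e (Suc n))))" .
qed

lemma fun2_app: "fun2 h \<Longrightarrow> fn s \<Longrightarrow> fn t \<Longrightarrow> fn (\<lambda>e. h (s e) (t e))"
proof (rule fnI)
  assume h: "fun2 h" and st: "fn s" "fn t"
  have "arith (\<lambda>e. e 0 = h (e 1) (e 2))"
    using h[unfolded fn_def] by (simp add: numeral_2_eq_2)
  from rel3_app[of "\<lambda>y x x'. y = h x x'", OF this fn_var[of 0] fn_rename[OF st(1)] fn_rename[OF st(2)]]
  show "arith (\<lambda>e. e 0 = h (s (\<lambda>n. e (Suc n))) (t (\<lambda>n. e (Suc n))))" .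
qed

lemma fn_plus: "fn s \<Longrightarrow> fn t \<Longrightarrow> fn (\<lambda>e. s e + t e)"
  by (rule fun2_app, rule fnI) (rule arith_pure[of "Eq (Var 0) (Add (Var 1) (Var 2))"], simp_all add: numeral_2_eq_2)

lemma fn_times: "fn s \<Longrightarrow> fn t \<Longrightarrow> fn (\<lambda>e. s e * t e)"
  by (rule fun2_app, rule fnI) (rule arith_pure[of "Eq (Var 0) (Mul (Var 1) (Var 2))"], simp_all add: numeral_2_eq_2)

lemmas arith_intros = arith_ball arith_bex arith_all arith_ex arith_imp arith_conj arith_disj arith_iff
  arith_not arith_eq arith_less arith_le fn_plus fn_times fn_var fn_const

lemma comprehension_arith: "rel1 P \<Longrightarrow> {x. P x} \<in> S"
proof -
  assume "rel1 P"
  then obtain p f where pf: "arithmetical p" "range f \<subseteq> S" and eq: "\<And>e. P (e 0) = holds S e f p"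
    unfolding arith_def by blast
  have "P x = holds S (case_nat x (\<lambda>_. 0)) f p" for x
    using eq[of "case_nat x (\<lambda>_. 0)"] by simp
  with comprehension[OF pf, of "\<lambda>_. 0"] show ?thesis by simp
qed

lemma arith_induct [case_names arith 0 Suc]:
  assumes "rel1 P" "P 0" "\<And>x. P x \<Longrightarrow> P (x + 1)"
  shows "P x"
  using set_induct[OF comprehension_arith[OF assms(1)]] assms(2,3) by simp

lemma less_plus_one_iff: "(x::'a) < y + 1 \<longleftrightarrow> x \<le> y"
proof
  assume "x < y + 1"
  show "x \<le> y"
  proof (rule ccontr)
    assume "\<not> x \<le> y"
    then have "y < x" by simp
    then obtain d where d: "x = y + d" using le_add_diff_inverse[of y x] less_imp_le by metis
    with \<open>y < x\<close> have "1 \<le> d" by (intro discrete) simp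
    with d \<open>x < y + 1\<close> show False by simp
  qed
qed (use add_strict_increasing2[of y 1] in \<open>simp add: le_less_trans[OF _ less_add_one]\<close>)

lemma arith_least:
  assumes "rel1 P" "P x"
  shows "\<exists>y. P y \<and> (\<forall>z<y. \<not> P z)"
proof (rule ccontr)
  assume no: "\<not> ?thesis"
  have "\<forall>z<n. \<not> P z" for n
  proof (induction n rule: arith_induct)
    case arith
    show ?case by (intro arith_intros rel1_app[OF assms(1)])
  next
    case 0
    show ?case using nonneg by (metis not_less)
  next
    case (Suc n)
    then show ?case using no less_plus_one_iff by (metis le_less)
  qed
  then show False using assms(2) less_add_one by blast
qed


section \<open>Coding finite sequences\<close>

definition code :: "'a \<Rightarrow> 'a \<Rightarrow> 'a" where
  "code x y = (x + y) * (x + y) + x"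

lemma fn_code: "fn s \<Longrightarrow> fn t \<Longrightarrow> fn (\<lambda>e. code (s e) (t e))"
  unfolding code_def by (intro arith_intros)

lemma code_less:
  assumes "x + y < x' + y'"
  shows "code x y < code x' y'"
proof -
  define s where "s = x + y"
  have "x \<le> s" using nonneg[of y] by (simp add: s_def)
  also have "s \<le> s + s" using nonneg[of s] by simp
  also have "\<dots> < s + s + 1" by simp
  finally have "s * s + x < s * s + (s + s + 1)" by simp
  also have "\<dots> = (s + 1) * (s + 1)" by (simp add: algebra_simps)
  also have "\<dots> \<le> (x' + y') * (x' + y')"
  proof -
    have "s + 1 \<le> x' + y'"
      using assms less_plus_one_iff[of "x' + y'" s] unfolding s_def by (meson not_less)
    then show ?thesis by (intro mult_mono nonneg)
  qed
  also have "\<dots> \<le> (x' + y') * (x' + y') + x'" using nonneg[of x'] by simp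
  finally show ?thesis by (simp add: code_def s_def)
qed

lemma code_eq_iff [simp]: "code x y = code x' y' \<longleftrightarrow> x = x' \<and> y = y'"
proof
  assume eq: "code x y = code x' y'"
  then have s: "x + y = x' + y'"
    using code_less[of x y x' y'] code_less[of x' y' x y] by (metis less_irrefl not_less_iff_gr_or_eq)
  then have "x = x'" using eq by (simp add: code_def)
  with s show "x = x' \<and> y = y'" by simp
qed simp

text \<open>
  Goedel's device: \<open>i\<close> belongs to the set coded by \<open>b\<close> and \<open>c\<close> if the modulus \<open>1 + (i + 1) * b\<close>
  divides \<open>c\<close>. Coding sets instead of sequences of remainders makes a product of moduli a code, so
  that the Chinese remainder theorem is not required.
\<close>

definition in_code :: "'a \<Rightarrow> 'a \<Rightarrow> bool" where
  "in_code i s \<longleftrightarrow> (\<exists>b c. s = code b c \<and> (1 + (i + 1) * b) dvd c)"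

lemma arith_in_code: "fn s \<Longrightarrow> fn t \<Longrightarrow> arith (\<lambda>e. in_code (s e) (t e))"
  by (rule rel2_app) (unfold in_code_def dvd_def, intro arith_intros fn_code)

lemma common_multiple: "\<exists>b::'a. 0 < b \<and> (\<forall>i<n. (i + 1) dvd b)"
proof (induction n rule: arith_induct)
  case arith
  show ?case unfolding dvd_def by (intro arith_intros)
next
  case 0
  show ?case using nonneg by (intro exI[of _ 1]) (simp add: not_less[symmetric])
next
  case (Suc n)
  then obtain b where b: "0 < b" "\<forall>i<n. (i + 1) dvd b" by blast
  have "0 < n + 1" using nonneg[of n] by (simp add: add_nonneg_pos)
  then show ?case
    using b by (intro exI[of _ "b * (n + 1)"]) (auto simp: less_plus_one_iff le_less)
qed

text \<open>
  Subtracting \<open>j + 1\<close> times the modulus of \<open>i\<close> from \<open>i + 1\<close> times the modulus of \<open>j\<close> leaves the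
  difference of \<open>i\<close> and \<open>j\<close>. This divides \<open>b\<close>, and \<open>b\<close> is invertible modulo the modulus of \<open>i\<close>.
  The argument needs neither gcds nor the Bezout identity, which would have to be proved by
  induction in the structure.
\<close>

lemma moduli_coprime:
  fixes i j b c n :: 'a
  assumes "i \<noteq> j" "i < n" "j < n" "\<forall>i<n. (i + 1) dvd b"
    and dvd: "(1 + (i + 1) * b) dvd (1 + (j + 1) * b) * c"
  shows "(1 + (i + 1) * b) dvd c"
proof -
  let ?m = "1 + (i + 1) * b"
  have finish: ?thesis if "?m dvd d * c" "d dvd b" for d
  proof -
    obtain k where "b = d * k" using \<open>d dvd b\<close> by blast
    moreover have "?m dvd d * c * k" using \<open>?m dvd d * c\<close> by (rule dvd_mult2)
    moreover have "d * c * k = d * k * c" by (simp only: mult.assoc mult.commute[of c k])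
    ultimately have "?m dvd b * c" by simp
    then have "?m dvd (i + 1) * b * c" by (simp add: mult.assoc dvd_mult)
    moreover have "?m * c = (i + 1) * b * c + c" by (simp add: algebra_simps)
    ultimately show ?thesis by (metis dvd_add_right_iff dvd_triv_left)
  qed
  have d: "(i + 1) * (1 + (j + 1) * b) * c + j * c = (j + 1) * (?m * c) + i * c"
    by (simp add: algebra_simps)
  have divides: "x - y dvd b" if "y < x" "x < n" for x y
  proof -
    obtain d where x: "x = y + d" using le_add_diff_inverse[of y x] \<open>y < x\<close> less_imp_le by metis
    then have "1 \<le> d" using that(1) by (intro discrete) simp
    then obtain d' where d': "d = d' + 1" using le_add_diff_inverse2 by metis
    have "d' < d" using d' by simp
    also have "d \<le> x" using x nonneg[of y] by simp
    also have "x < n" by (rule that(2))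
    finally have "d' < n" .
    then show ?thesis using assms(4) x d' by simp
  qed
  have m1: "?m dvd (i + 1) * (1 + (j + 1) * b) * c"
    using dvd by (simp add: mult.assoc dvd_mult)
  have m2: "?m dvd (j + 1) * (?m * c)" by simp
  show ?thesis
  proof (cases "i < j")
    case True
    then obtain d where j: "j = i + d" using le_add_diff_inverse less_imp_le by metis
    have "(i + 1) * (1 + (j + 1) * b) * c + d * c = (j + 1) * (?m * c)"
      using d by (simp add: j algebra_simps)
    then have "?m dvd d * c" using m1 m2 by (metis dvd_add_right_iff)
    moreover have "d dvd b" using divides[OF True assms(3)] by (simp add: j)
    ultimately show ?thesis by (rule finish)
  next
    case False
    with assms(1) have "j < i" by simp
    then obtain d where i: "i = j + d" using le_add_diff_inverse less_imp_le by metis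
    have "(i + 1) * (1 + (j + 1) * b) * c = (j + 1) * (?m * c) + d * c"
      using d by (simp add: i algebra_simps)
    then have "?m dvd d * c" using m1 m2 by (metis dvd_add_right_iff)
    moreover have "d dvd b" using divides[OF \<open>j < i\<close> assms(2)] by (simp add: i)
    ultimately show ?thesis by (rule finish)
  qed
qed

text \<open>
  The code is the product of the moduli of the elements, built up by induction on \<open>k\<close>; the moduli
  of other indices are coprime to it.
\<close>

lemma finite_set_code:
  assumes "rel1 X"
  shows "\<exists>s. \<forall>i<n. in_code i s \<longleftrightarrow> X i"
proof -
  obtain b where b: "0 < b" "\<forall>i<n. (i + 1) dvd b" using common_multiple by blast
  let ?m = "\<lambda>i. 1 + (i + 1) * b"
  have "\<exists>c. \<forall>i<n. ?m i dvd c \<longleftrightarrow> i < k \<and> X i" for k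
  proof (induction k rule: arith_induct)
    case arith
    show ?case unfolding dvd_def by (intro arith_intros rel1_app[OF assms])
  next
    case 0
    have "\<not> ?m i dvd 1" for i
    proof
      assume "?m i dvd 1"
      then obtain k where k: "?m i * k = 1" by (metis dvd_def)
      then have "0 < k" using nonneg[of k] by (cases "k = 0") auto
      then have "1 \<le> k" by (rule discrete)
      have "1 < ?m i" using b(1) nonneg[of i] by (simp add: add_nonneg_pos)
      then have "1 * 1 < ?m i * k" using \<open>1 \<le> k\<close> by (intro mult_less_le_imp_less) simp_all
      with k show False by simp
    qed
    then show ?case using nonneg by (intro exI[of _ 1]) (auto simp: not_less)
  next
    case (Suc k)
    then obtain c where c: "\<forall>i<n. ?m i dvd c \<longleftrightarrow> i < k \<and> X i" by blast
    have less: "i < k + 1 \<longleftrightarrow> i < k \<or> i = k" for i by (auto simp: less_plus_one_iff)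
    show ?case
    proof (cases "X k \<and> k < n")
      case True
      have "?m i dvd ?m k * c \<longleftrightarrow> i < k + 1 \<and> X i" if "i < n" for i
      proof (cases "i = k")
        case False
        have "?m i dvd ?m k * c \<longleftrightarrow> ?m i dvd c"
        proof
          show "?m i dvd ?m k * c \<Longrightarrow> ?m i dvd c"
            by (rule moduli_coprime[OF False that _ b(2)]) (use True in blast)
        qed (rule dvd_mult)
        moreover have "?m i dvd c \<longleftrightarrow> i < k \<and> X i" using c that by blast
        ultimately show ?thesis using False less by blast
      qed (use True less in auto)
      then show ?thesis by blast
    next
      case False
      then show ?thesis using c less by (intro exI[of _ c]) auto
    qed
  qed
  then obtain c where "\<forall>i<n. ?m i dvd c \<longleftrightarrow> i < n \<and> X i" by blast
  then have "\<forall>i<n. in_code i (code b c) \<longleftrightarrow> X i" by (simp add: in_code_def)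
  then show ?thesis ..
qed

text \<open>
  A sequence is coded as the set of the pairs of its graph. Taking the least value makes \<open>entry\<close> a
  function even though nothing is known about the coded set beyond the bound: the pairs with a
  smaller value have smaller codes and therefore fall under the bound as well.
\<close>

definition entry :: "'a \<Rightarrow> 'a \<Rightarrow> 'a" where
  "entry s i = (if \<exists>y. in_code (code i y) s then LEAST y. in_code (code i y) s else 0)"

lemma entry_eq_iff:
  "y = entry s i \<longleftrightarrow> in_code (code i y) s \<and> (\<forall>z<y. \<not> in_code (code i z) s) \<or>
     \<not> (\<exists>z. in_code (code i z) s) \<and> y = 0"
proof -
  have "rel1 (\<lambda>y. in_code (code i y) s)"
    by (intro arith_intros arith_in_code fn_code)
  note least = arith_least[OF this]
  have L: "(LEAST y. in_code (code i y) s) = y"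
    if "in_code (code i y) s" "\<forall>z<y. \<not> in_code (code i z) s" for y
    using that by (intro Least_equality) (auto simp: not_less[symmetric])
  show ?thesis
  proof (cases "\<exists>z. in_code (code i z) s")
    case True
    then obtain x where x: "in_code (code i x) s" "\<forall>z<x. \<not> in_code (code i z) s"
      using least by blast
    then have "entry s i = x" using L[OF x] True by (simp add: entry_def)
    then show ?thesis using x True by (metis not_less_iff_gr_or_eq)
  qed (simp add: entry_def)
qed

lemma fn_entry: "fn s \<Longrightarrow> fn t \<Longrightarrow> fn (\<lambda>e. entry (s e) (t e))"
proof -
  have "fun2 entry"
    by (rule fnI) (unfold entry_eq_iff, intro arith_intros arith_in_code fn_code)
  then show "fn s \<Longrightarrow> fn t \<Longrightarrow> ?thesis" by (rule fun2_app)
qed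

lemma bounded_on_initial_segment:
  assumes "fun1 h"
  shows "\<exists>b. \<forall>i<n. h i < b"
proof (induction n rule: arith_induct)
  case arith
  show ?case by (intro arith_intros fun1_app[OF assms])
next
  case 0
  show ?case using nonneg by (auto simp: not_less[symmetric])
next
  case (Suc n)
  then obtain b where b: "\<forall>i<n. h i < b" by blast
  have "h i < b + h n + 1" if "i < n + 1" for i
  proof (cases "i = n")
    case True
    then show ?thesis using nonneg[of b] less_plus_one_iff by simp
  next
    case False
    then have "i < n" using that less_plus_one_iff by simp
    then have "h i < b" using b by blast
    also have "b \<le> b + h n" using nonneg[of "h n"] by simp
    also have "\<dots> < b + h n + 1" by simp
    finally show ?thesis .
  qed
  then show ?case by blast
qed

lemma sequence_code:
  assumes "fun1 h"
  shows "\<exists>s. \<forall>i<n. entry s i = h i"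
proof -
  obtain b where b: "\<forall>i<n. h i < b" using bounded_on_initial_segment[OF assms] by blast
  let ?X = "\<lambda>x. \<exists>i<n. x = code i (h i)"
  have "rel1 ?X" by (intro arith_intros fn_code fun1_app[OF assms])
  from finite_set_code[OF this, of "code n b"]
  obtain s where s: "\<forall>x < code n b. in_code x s \<longleftrightarrow> ?X x" ..
  have "entry s i = h i" if "i < n" for i
  proof -
    have small: "code i y < code n b" if "y \<le> h i" for y
    proof (rule code_less)
      have "y < b" using b \<open>i < n\<close> that by (metis le_less_trans)
      with \<open>i < n\<close> show "i + y < n + b" by (intro add_strict_mono)
    qed
    have in_code_iff: "in_code (code i y) s \<longleftrightarrow> y = h i" if "y \<le> h i" for y
      using s small[OF that] \<open>i < n\<close> by auto
    have "in_code (code i (h i)) s" using in_code_iff by simp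
    moreover have "\<forall>z<h i. \<not> in_code (code i z) s"
    proof (intro allI impI)
      fix z assume "z < h i"
      then show "\<not> in_code (code i z) s" using in_code_iff[of z] by simp
    qed
    ultimately show ?thesis using entry_eq_iff[of "h i" s i] by simp
  qed
  then show ?thesis by blast
qed

lemma extend_sequence_code: "\<exists>t. (\<forall>i<n. entry t i = entry s i) \<and> entry t n = x"
proof -
  define h where "h i = (if i < n then entry s i else x)" for i
  have "y = h i \<longleftrightarrow> (i < n \<and> y = entry s i) \<or> (\<not> i < n \<and> y = x)" for y i
    by (auto simp: h_def)
  then have "fun1 h" unfolding fn_def by (simp only:) (intro arith_intros fn_entry)
  then obtain t where "\<forall>i<n + 1. entry t i = h i" using sequence_code by blast
  then show ?thesis by (intro exI[of _ t]) (auto simp: h_def less_plus_one_iff)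
qed

section \<open>Recursion and dependent choice\<close>

text \<open>
  The value at \<open>n\<close> is the last entry of any code of a computation of length \<open>n\<close>. Computations
  exist and agree by induction, which is arithmetical because they are numbers.
\<close>

lemma primitive_recursion:
  assumes g: "fun2 g"
  shows "\<exists>h. fun1 h \<and> h 0 = a \<and> (\<forall>n. h (n + 1) = g n (h n))"
proof -
  define comp where "comp s n \<longleftrightarrow> entry s 0 = a \<and> (\<forall>i<n. entry s (i + 1) = g i (entry s i))" for s n
  have comp_arith: "arith (\<lambda>e. comp (s e) (t e))" if "fn s" "fn t" for s t
    by (rule rel2_app[OF _ that]) (unfold comp_def, intro arith_intros fn_entry fun2_app[OF g])
  have unique: "i \<le> n \<longrightarrow> i \<le> m \<longrightarrow> entry s i = entry t i" if "comp s n" "comp t m" for s t n m i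
  proof (induction i rule: arith_induct)
    case arith
    show ?case by (intro arith_intros fn_entry)
  next
    case 0
    show ?case using that by (simp add: comp_def)
  next
    case (Suc i)
    show ?case
    proof (intro impI)
      assume "i + 1 \<le> n" "i + 1 \<le> m"
      then have "i < n" "i < m" using less_add_one[of i] by (metis less_le_trans)+
      then show "entry s (i + 1) = entry t (i + 1)" using Suc that by (simp add: comp_def)
    qed
  qed
  have exist: "\<exists>s. comp s n" for n
  proof (induction n rule: arith_induct)
    case arith
    show ?case by (intro arith_intros comp_arith)
  next
    case 0
    obtain t where "entry t 0 = a" using extend_sequence_code by blast
    then show ?case using nonneg by (intro exI[of _ t]) (auto simp: comp_def not_less[symmetric])
  next
    case (Suc n)
    then obtain s where s: "comp s n" by blast
    obtain t where t: "\<forall>i<n + 1. entry t i = entry s i" "entry t (n + 1) = g n (entry s n)"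
      using extend_sequence_code by blast
    have "entry t (i + 1) = g i (entry t i)" if "i < n + 1" for i
    proof (cases "i = n")
      case False
      then have "i < n" using that less_plus_one_iff by simp
      then have "i + 1 < n + 1" by simp
      then show ?thesis using t(1) that s \<open>i < n\<close> by (simp add: comp_def)
    qed (use t in simp)
    moreover have "entry t 0 = a"
      using t(1) s nonneg[of n] by (simp add: comp_def add_nonneg_pos)
    ultimately show ?case unfolding comp_def by blast
  qed
  define h where "h n = (THE y. \<exists>s. comp s n \<and> y = entry s n)" for n
  have h: "h n = entry s n" if "comp s n" for n s
    unfolding h_def
  proof (rule the_equality)
    show "\<exists>s'. comp s' n \<and> entry s n = entry s' n" using that by blast
    fix y assume "\<exists>s'. comp s' n \<and> y = entry s' n"
    then obtain s' where "comp s' n" "y = entry s' n" by blast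
    then show "y = entry s n" using unique[OF _ that, of s' n n] by simp
  qed
  have "y = h n \<longleftrightarrow> (\<exists>s. comp s n \<and> y = entry s n)" for y n
    using exist[of n] h by metis
  then have "fun1 h" unfolding fn_def by (simp only:) (intro arith_intros comp_arith fn_entry)
  moreover have "h 0 = a"
  proof -
    obtain s where "comp s 0" using exist by blast
    then show ?thesis using h[of s 0] by (simp add: comp_def)
  qed
  moreover have "h (n + 1) = g n (h n)" for n
  proof -
    obtain s where s: "comp s (n + 1)" using exist by blast
    have "i < n \<Longrightarrow> i < n + 1" for i by (rule less_trans[OF _ less_add_one])
    with s have "comp s n" unfolding comp_def by simp
    from h[OF this] h[OF s] s show ?thesis by (simp add: comp_def)
  qed
  ultimately show ?thesis by blast
qed

lemma least_choice:
  assumes "rel3 R" "\<And>n x. P x \<Longrightarrow> \<exists>y. R n x y"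
  shows "\<exists>g. fun2 g \<and> (\<forall>n x. P x \<longrightarrow> R n x (g n x))"
proof -
  define g where "g n x = (if \<exists>y. R n x y then LEAST y. R n x y else 0)" for n x
  have R_arith: "arith (\<lambda>e. R (s e) (t e) (u e))" if "fn s" "fn t" "fn u" for s t u
    by (rule rel3_app[OF assms(1) that])
  have g: "y = g n x \<longleftrightarrow> R n x y \<and> (\<forall>z<y. \<not> R n x z) \<or> \<not> (\<exists>z. R n x z) \<and> y = 0" for y n x
  proof -
    have "rel1 (R n x)" by (intro R_arith arith_intros)
    note least = arith_least[OF this]
    have L: "(LEAST y. R n x y) = y" if "R n x y" "\<forall>z<y. \<not> R n x z" for y
      using that by (intro Least_equality) (auto simp: not_less[symmetric])
    show ?thesis
    proof (cases "\<exists>z. R n x z")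
      case True
      then obtain w where w: "R n x w" "\<forall>z<w. \<not> R n x z" using least by blast
      then have "g n x = w" using L[OF w] True by (simp add: g_def)
      then show ?thesis using w True by (metis not_less_iff_gr_or_eq)
    qed (simp add: g_def)
  qed
  then have "fun2 g" unfolding fn_def by (simp only:) (intro arith_intros R_arith)
  moreover have "R n x (g n x)" if "P x" for n x
    using g[of "g n x" n x] assms(2)[OF that] by blast
  ultimately show ?thesis by blast
qed

text \<open>
  Choices are made canonical by always taking the least number that works.
\<close>

lemma dependent_choice:
  assumes "rel1 P" "rel3 R" "P a" "\<And>n x. P x \<Longrightarrow> \<exists>y. P y \<and> R n x y"
  shows "\<exists>h. fun1 h \<and> h 0 = a \<and> (\<forall>n. P (h n) \<and> R n (h n) (h (n + 1)))"
proof -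
  have "rel3 (\<lambda>n x y. P y \<and> R n x y)"
    by (intro arith_intros rel1_app[OF assms(1)] rel3_app[OF assms(2)])
  from least_choice[OF this assms(4)]
  obtain g where g: "fun2 g" "\<And>n x. P x \<Longrightarrow> P (g n x) \<and> R n x (g n x)" by blast
  obtain h where h: "fun1 h" "h 0 = a" "\<And>n. h (n + 1) = g n (h n)"
    using primitive_recursion[OF g(1)] by blast
  have "P (h n)" for n
  proof (induction n rule: arith_induct)
    case arith
    show ?case by (intro rel1_app[OF assms(1)] fun1_app[OF h(1)] arith_intros)
  qed (use h assms(3) g(2) in auto)
  then show ?thesis using h g(2) by (intro exI[of _ h]) simp
qed

lemma rel4_app:
  assumes "arith (\<lambda>e. R (e 0) (e 1) (e 2) (e 3))" "fn s" "fn t" "fn u" "fn v"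
  shows "arith (\<lambda>e. R (s e) (t e) (u e) (v e))"
proof (rule arith_let[OF assms(2)], rule arith_let[OF fn_rename[OF assms(3)]],
    rule arith_let[OF fn_rename[OF fn_rename[OF assms(4)]]],
    rule arith_let[OF fn_rename[OF fn_rename[OF fn_rename[OF assms(5)]]]])
  show "arith (\<lambda>e. R (e (Suc (Suc (Suc 0)))) (e (Suc (Suc 0))) (e (Suc 0)) (e 0))"
    using arith_rename[OF assms(1), of "\<lambda>n. 3 - n"] by (simp add: numeral_2_eq_2 numeral_3_eq_3)
qed

text \<open>
  States with two components are coded as a single number.
\<close>

lemma dependent_choice_pairs:
  assumes P: "rel2 P" and R: "arith (\<lambda>e. R (e 0) (e 1) (e 2) (e 3))" and "P a b"
    and step: "\<And>x y. P x y \<Longrightarrow> \<exists>x' y'. P x' y' \<and> R x y x' y'"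
  obtains h k where "fun1 h" "fun1 k" "\<And>n. P (h n) (k n)"
    "\<And>n. R (h n) (k n) (h (n + 1)) (k (n + 1))"
proof -
  let ?P = "\<lambda>z. \<exists>x y. z = code x y \<and> P x y"
  let ?R = "\<lambda>n z z'. \<exists>x y x' y'. z = code x y \<and> z' = code x' y' \<and> R x y x' y'"
  have "rel1 ?P" by (intro arith_intros fn_code rel2_app[OF P])
  moreover have "rel3 ?R" by (intro arith_intros fn_code rel4_app[OF R])
  moreover have "?P (code a b)" using \<open>P a b\<close> by auto
  moreover have "\<exists>z'. ?P z' \<and> ?R n z z'" if "?P z" for n z
    using that step by fast
  ultimately obtain H where H: "fun1 H" "\<And>n. ?P (H n)" "\<And>n. ?R n (H n) (H (n + 1))"
    using dependent_choice[of ?P ?R "code a b"] by blast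
  define h where "h n = (THE x. \<exists>y. H n = code x y)" for n
  define k where "k n = (THE y. \<exists>x. H n = code x y)" for n
  have hk: "h n = x \<and> k n = y" if "H n = code x y" for n x y
    using that by (simp add: h_def k_def)
  have "x = h n \<longleftrightarrow> (\<exists>y. H n = code x y)" "x = k n \<longleftrightarrow> (\<exists>y. H n = code y x)" for x n
    using H(2)[of n] hk by auto
  then have "fun1 h" "fun1 k"
    unfolding fn_def by (simp_all only:) (intro arith_intros fn_code fun1_app[OF H(1)])+
  moreover have "P (h n) (k n)" for n using H(2)[of n] hk by auto
  moreover have "R (h n) (k n) (h (n + 1)) (k (n + 1))" for n
    using H(3)[of n] hk by auto
  ultimately show ?thesis by (rule that)
qed


section \<open>Unbounded sets and chains\<close>

definition unbounded :: "'a set \<Rightarrow> bool" where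
  "unbounded X \<longleftrightarrow> (\<forall>m. \<exists>n>m. n \<in> X)"

text \<open>
  Stands in for the pigeonhole principle: each value is taken at most once, so the induction on
  the bound \<open>m\<close> only has to step past the one argument at which \<open>m\<close> itself is taken.
\<close>

lemma injective_eventually_large:
  assumes "fun1 h" "\<And>i j. i < j \<Longrightarrow> h i \<noteq> h j"
  shows "\<exists>N. \<forall>n\<ge>N. m \<le> h n"
proof (induction m rule: arith_induct)
  case arith
  show ?case by (intro arith_intros fun1_app[OF assms(1)])
next
  case 0
  show ?case using nonneg by blast
next
  case (Suc m)
  then obtain N where N: "\<forall>n\<ge>N. m \<le> h n" by blast
  have succ: "m + 1 \<le> h n" if "m \<le> h n" "h n \<noteq> m" for n
    using that less_plus_one_iff[of "h n" m] by (metis antisym not_less)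
  show ?case
  proof (cases "\<exists>k. h k = m")
    case True
    then obtain k where k: "h k = m" by blast
    have "m + 1 \<le> h n" if "N + k + 1 \<le> n" for n
    proof (rule succ)
      have "k \<le> N + k" using nonneg[of N] by simp
      also have "\<dots> < N + k + 1" by simp
      also have "\<dots> \<le> n" by (rule that)
      finally show "h n \<noteq> m" using assms(2) k by metis
      have "N \<le> N + (k + 1)" using nonneg[of "k + 1"] by simp
      also have "\<dots> \<le> n" using that by (simp add: add.assoc)
      finally show "m \<le> h n" using N by simp
    qed
    then show ?thesis by blast
  next
    case False
    then show ?thesis using N succ by blast
  qed
qed

lemma injective_unbounded:
  assumes "fun1 h" "\<And>i j. i < j \<Longrightarrow> h i \<noteq> h j"
  shows "\<exists>k\<ge>n. m < h k"
proof -
  obtain N where N: "\<forall>k\<ge>N. m + 1 \<le> h k" using injective_eventually_large[OF assms] by blast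
  have "m + 1 \<le> h (N + n)" using N nonneg[of n] by simp
  then have "m < h (N + n)" using less_add_one by (rule less_le_trans[rotated])
  then show ?thesis using nonneg[of N] by (intro exI[of _ "N + n"]) simp
qed

lemma monotone_sequence:
  assumes "rel2 r" "fun1 h" "\<And>n. r (h n) (h n)" "\<And>n. r (h n) (h (n + 1))"
    and trans: "\<And>x y z. r x y \<Longrightarrow> r y z \<Longrightarrow> r x z" and "i \<le> j"
  shows "r (h i) (h j)"
proof -
  have "i \<le> j \<longrightarrow> r (h i) (h j)" for j
  proof (induction j rule: arith_induct)
    case arith
    show ?case by (intro arith_intros rel2_app[OF assms(1)] fun1_app[OF assms(2)])
  next
    case 0
    show ?case using assms(3) nonneg[of i] by (auto dest: antisym)
  next
    case (Suc j)
    then show ?case using assms(3,4) trans less_plus_one_iff[of i j] by (metis le_less)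
  qed
  with \<open>i \<le> j\<close> show ?thesis by blast
qed

lemma less_cases_succ: "i < (j::'a) \<Longrightarrow> \<exists>k. j = k + 1 \<and> i \<le> k"
proof -
  assume "i < j"
  then have "i + 1 \<le> j" using less_plus_one_iff[of j i] by (meson not_less)
  then obtain d where "j = i + 1 + d" using le_add_diff_inverse by metis
  then show ?thesis using nonneg[of d] by (intro exI[of _ "i + d"]) (simp add: algebra_simps)
qed

end

text \<open>
  The domain of the order is the set of the \<open>x\<close> with \<open>x \<preceq> x\<close>; elsewhere the relation is false.
  Unboundedness among the numbers is the internal notion of infinity.
\<close>

locale order_structure = aca_structure +
  fixes le :: "'a \<Rightarrow> 'a \<Rightarrow> bool" (infix "\<preceq>" 50)
  assumes le_rel2: "rel2 (\<preceq>)"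
    and le_field: "x \<preceq> y \<Longrightarrow> x \<preceq> x \<and> y \<preceq> y"
    and le_trans: "x \<preceq> y \<Longrightarrow> y \<preceq> z \<Longrightarrow> x \<preceq> z"
    and le_antisym: "x \<preceq> y \<Longrightarrow> y \<preceq> x \<Longrightarrow> x = y"
    and no_antichain: "A \<in> S \<Longrightarrow> unbounded A \<Longrightarrow> (\<And>x. x \<in> A \<Longrightarrow> x \<preceq> x) \<Longrightarrow>
      \<exists>x\<in>A. \<exists>y\<in>A. x \<noteq> y \<and> x \<preceq> y"
begin

lemma arith_order: "fn s \<Longrightarrow> fn t \<Longrightarrow> arith (\<lambda>e. s e \<preceq> t e)"
  by (rule rel2_app[OF le_rel2])

lemma dual_order_structure: "order_structure S (\<lambda>x y. y \<preceq> x)"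
proof
  show "arith (\<lambda>e. e 1 \<preceq> e 0)" by (intro arith_order arith_intros)
  show "\<exists>x\<in>A. \<exists>y\<in>A. x \<noteq> y \<and> y \<preceq> x"
    if A: "A \<in> S" "unbounded A" "\<And>x. x \<in> A \<Longrightarrow> x \<preceq> x" for A
  proof -
    obtain x y where "x \<in> A" "y \<in> A" "x \<noteq> y" "x \<preceq> y" using no_antichain[OF A] by metis
    then show ?thesis by (intro bexI[of _ y] bexI[of _ x]) auto
  qed
  show "y \<preceq> x \<Longrightarrow> x \<preceq> x \<and> y \<preceq> y" for x y using le_field by simp
  show "y \<preceq> x \<Longrightarrow> z \<preceq> y \<Longrightarrow> z \<preceq> x" for x y z by (rule le_trans)
  show "y \<preceq> x \<Longrightarrow> x \<preceq> y \<Longrightarrow> x = y" for x y by (rule le_antisym)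
qed

lemma no_antichain_sequence:
  assumes "fun1 h" "\<And>n. h n \<preceq> h n" "\<And>i j. i < j \<Longrightarrow> \<not> h i \<preceq> h j \<and> \<not> h j \<preceq> h i"
  shows False
proof -
  let ?A = "{y. \<exists>n. y = h n}"
  have "?A \<in> S" by (intro comprehension_arith arith_intros fun1_app[OF assms(1)])
  moreover have "h i \<noteq> h j" if "i < j" for i j
    using assms(2,3) that by metis
  then have "unbounded ?A"
    using injective_unbounded[OF assms(1)] unfolding unbounded_def by blast
  ultimately obtain i j where "h i \<noteq> h j" "h i \<preceq> h j"
    using no_antichain[of ?A] assms(2) by blast
  then show False using assms(3)[of i j] assms(3)[of j i] by (metis not_less_iff_gr_or_eq)
qed

text \<open>
  Otherwise every element \<open>c\<close> of \<open>C\<close> has above it some \<open>x \<in> X\<close> and \<open>c' \<in> C\<close> that are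
  incompatible in \<open>X\<close>. Iterating along the \<open>c'\<close> yields a sequence of elements of \<open>X\<close> each of
  which is incompatible with a lower bound of all later ones, and this makes the sequence an
  antichain.
\<close>

lemma compatible_above:
  assumes "X \<in> S" "C \<in> S" "c\<^sub>0 \<in> C" and X: "\<And>x. x \<in> X \<Longrightarrow> x \<preceq> x" and C: "\<And>x. x \<in> C \<Longrightarrow> x \<preceq> x"
  shows "\<exists>c\<in>C. \<forall>x\<in>X. \<forall>c'\<in>C. c \<preceq> x \<longrightarrow> c \<preceq> c' \<longrightarrow> (\<exists>z\<in>X. x \<preceq> z \<and> c' \<preceq> z)"
proof (rule ccontr)
  assume no: "\<not> ?thesis"
  let ?P = "\<lambda>x c. x \<in> X \<and> c \<in> C \<and> \<not> (\<exists>z\<in>X. x \<preceq> z \<and> c \<preceq> z)"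
  let ?R = "\<lambda>x c x' c'. c \<preceq> x' \<and> c \<preceq> c'"
  note intros = arith_intros arith_order arith_mem[OF assms(1)] arith_mem[OF assms(2)]
  have step: "\<exists>x' c'. ?P x' c' \<and> ?R x c x' c'" if "c \<in> C" for x c
    using no that by blast
  obtain a b where ab: "?P a b" using step[OF assms(3)] by blast
  have P: "rel2 ?P" by (intro intros)
  have R: "arith (\<lambda>e. ?R (e 0) (e 1) (e 2) (e 3))" by (intro intros)
  obtain h k where hk: "fun1 h" "fun1 k" "\<And>n. ?P (h n) (k n)"
    "\<And>n. k n \<preceq> h (n + 1) \<and> k n \<preceq> k (n + 1)"
    by (rule dependent_choice_pairs[of ?P ?R a b, OF P R ab]) (use step in blast)+
  have k_mono: "k i \<preceq> k j" if "i \<le> j" for i j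
    by (rule monotone_sequence[OF le_rel2 hk(2) _ _ le_trans that]) (use hk(3,4) C in auto)
  have k_h: "k i \<preceq> h j" if ij: "i < j" for i j
  proof -
    obtain l where "j = l + 1" "i \<le> l" using less_cases_succ[OF ij] by blast
    then show ?thesis using k_mono hk(4) le_trans by blast
  qed
  show False
  proof (rule no_antichain_sequence[OF hk(1)])
    show "h n \<preceq> h n" for n using hk(3) X by blast
    show "\<not> h i \<preceq> h j \<and> \<not> h j \<preceq> h i" if "i < j" for i j
      using k_h[OF that] hk(3)[of i] hk(3)[of j] X le_trans by blast
  qed
qed

text \<open>
  Bounds on the elements comparable with the members chosen so far are carried along, and every
  new member is chosen beyond them.
\<close>

lemma no_sparse_set:
  assumes "Z \<in> S" "unbounded Z" and Z: "\<And>z. z \<in> Z \<Longrightarrow> z \<preceq> z"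
    and sparse: "\<And>z. z \<in> Z \<Longrightarrow> \<exists>b. \<forall>y\<in>Z. y \<preceq> z \<or> z \<preceq> y \<longrightarrow> y < b"
  shows False
proof -
  let ?P = "\<lambda>x b. x \<in> Z \<and> (\<forall>y\<in>Z. y \<preceq> x \<or> x \<preceq> y \<longrightarrow> y < b)"
  let ?R = "\<lambda>x b x' b'. b \<le> x' \<and> b \<le> b'"
  note intros = arith_intros arith_order arith_mem[OF assms(1)]
  have step: "\<exists>x' b'. ?P x' b' \<and> ?R x b x' b'" for x b
  proof -
    obtain x' where x': "b < x'" "x' \<in> Z" using assms(2) unfolding unbounded_def by blast
    obtain b' where b': "\<forall>y\<in>Z. y \<preceq> x' \<or> x' \<preceq> y \<longrightarrow> y < b'" using sparse[OF x'(2)] by blast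
    have "y < b' + b" if "y < b'" for y using add_less_le_mono[OF that nonneg[of b]] by simp
    then have "?P x' (b' + b)" using b' x' by blast
    moreover have "?R x b x' (b' + b)" using x' nonneg[of b'] by simp
    ultimately show ?thesis by blast
  qed
  obtain a b where ab: "?P a b" using step by blast
  have P: "rel2 ?P" by (intro intros)
  have R: "arith (\<lambda>e. ?R (e 0) (e 1) (e 2) (e 3))" by (intro intros)
  obtain h k where hk: "fun1 h" "fun1 k" "\<And>n. ?P (h n) (k n)"
    "\<And>n. k n \<le> h (n + 1) \<and> k n \<le> k (n + 1)"
    by (rule dependent_choice_pairs[of ?P ?R a b, OF P R ab]) (use step in blast)+
  have "rel2 (\<le>)" by (intro intros)
  then have k_mono: "k i \<le> k j" if "i \<le> j" for i j
    by (rule monotone_sequence[OF _ hk(2) _ _ order_trans that]) (use hk(4) in auto)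
  have k_h: "k i \<le> h j" if ij: "i < j" for i j
  proof -
    obtain l where "j = l + 1" "i \<le> l" using less_cases_succ[OF ij] by blast
    then show ?thesis using k_mono hk(4) order_trans by blast
  qed
  show False
  proof (rule no_antichain_sequence[OF hk(1)])
    show "h n \<preceq> h n" for n using hk(3) Z by blast
    show "\<not> h i \<preceq> h j \<and> \<not> h j \<preceq> h i" if "i < j" for i j
      using k_h[OF that] hk(3)[of i] hk(3)[of j] by (meson not_less)
  qed
qed

section \<open>Directed sets without a maximum\<close>

definition ideal :: "'a set \<Rightarrow> bool" where
  "ideal D \<longleftrightarrow> (\<exists>x. x \<in> D) \<and> (\<forall>x\<in>D. x \<preceq> x) \<and> (\<forall>x\<in>D. \<forall>y\<in>D. \<exists>z\<in>D. x \<preceq> z \<and> y \<preceq> z) \<and>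
     (\<forall>x\<in>D. \<exists>y\<in>D. x \<preceq> y \<and> x \<noteq> y)"

text \<open>
  Let \<open>U\<close> consist of the elements of \<open>Z\<close> with unboundedly many elements of \<open>Z\<close> above them. Since \<open>U\<close>
  is directed above some element and there are no ideals, a nonempty \<open>U\<close> has a maximal element;
  the elements of \<open>Z\<close> strictly above it are unboundedly many, and none of them is in \<open>U\<close>.
\<close>

lemma thin_out:
  assumes "Z \<in> S" "unbounded Z" and Z: "\<And>z. z \<in> Z \<Longrightarrow> z \<preceq> z" and no: "\<And>D. D \<in> S \<Longrightarrow> \<not> ideal D"
  shows "\<exists>Z'\<in>S. Z' \<subseteq> Z \<and> unbounded Z' \<and> (\<forall>z\<in>Z'. \<exists>b. \<forall>y\<in>Z'. z \<preceq> y \<longrightarrow> y < b)"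
proof -
  define U where "U = {z. z \<in> Z \<and> (\<forall>m. \<exists>n>m. n \<in> Z \<and> z \<preceq> n)}"
  note intros = arith_intros arith_order arith_mem[OF assms(1)]
  have "U \<in> S" unfolding U_def by (intro comprehension_arith intros)
  have bound: "\<exists>b. \<forall>y\<in>Z. z \<preceq> y \<longrightarrow> y < b" if z: "z \<in> Z" "z \<notin> U" for z
  proof -
    obtain m where "\<not> (\<exists>n>m. n \<in> Z \<and> z \<preceq> n)"
      using z unfolding U_def by blast
    then have "\<forall>y\<in>Z. z \<preceq> y \<longrightarrow> y < m + 1" using less_plus_one_iff by (meson not_less)
    then show ?thesis ..
  qed
  show ?thesis
  proof (cases "U = {}")
    case True
    then show ?thesis using assms(1,2) bound by (intro bexI[of _ Z]) simp_all
  next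
    case False
    then obtain u\<^sub>0 where "u\<^sub>0 \<in> U" by blast
    have U: "x \<preceq> x" if "x \<in> U" for x using that Z by (simp add: U_def)
    have "\<exists>c\<in>U. \<forall>x\<in>U. \<forall>y\<in>U. c \<preceq> x \<longrightarrow> c \<preceq> y \<longrightarrow> (\<exists>z\<in>U. x \<preceq> z \<and> y \<preceq> z)"
      by (rule compatible_above[OF \<open>U \<in> S\<close> \<open>U \<in> S\<close> \<open>u\<^sub>0 \<in> U\<close> U U])
    then obtain c where c: "c \<in> U"
      "\<forall>x\<in>U. \<forall>y\<in>U. c \<preceq> x \<longrightarrow> c \<preceq> y \<longrightarrow> (\<exists>z\<in>U. x \<preceq> z \<and> y \<preceq> z)" ..
    let ?D = "{x. x \<in> U \<and> c \<preceq> x}"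
    have "?D \<in> S" by (intro comprehension_arith intros arith_mem[OF \<open>U \<in> S\<close>])
    then have "\<not> ideal ?D" by (rule no)
    moreover have "\<exists>x. x \<in> ?D" "\<forall>x\<in>?D. x \<preceq> x" using c(1) U by auto
    moreover have "\<forall>x\<in>?D. \<forall>y\<in>?D. \<exists>z\<in>?D. x \<preceq> z \<and> y \<preceq> z"
    proof (intro ballI)
      fix x y assume xy: "x \<in> ?D" "y \<in> ?D"
      then obtain z where "z \<in> U" "x \<preceq> z" "y \<preceq> z" using c(2) by auto
      moreover from this have "c \<preceq> z" using xy le_trans[of c x z] by simp
      ultimately show "\<exists>z\<in>?D. x \<preceq> z \<and> y \<preceq> z" by auto
    qed
    ultimately have "\<not> (\<forall>x\<in>?D. \<exists>y\<in>?D. x \<preceq> y \<and> x \<noteq> y)" unfolding ideal_def by iprover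
    then obtain u where "u \<in> ?D" and max: "\<forall>y\<in>?D. \<not> (u \<preceq> y \<and> u \<noteq> y)" by auto
    then have u: "u \<in> U" "c \<preceq> u" by simp_all
    have u_max: "y = u" if "y \<in> U" "u \<preceq> y" for y
      using max that le_trans[OF u(2) that(2)] by auto
    let ?Z = "{z. z \<in> Z \<and> u \<preceq> z \<and> z \<noteq> u}"
    have "?Z \<in> S" by (intro comprehension_arith intros)
    moreover have "unbounded ?Z"
      unfolding unbounded_def
    proof
      fix m
      obtain n where n: "m + u < n" "n \<in> Z" "u \<preceq> n" using u(1) by (auto simp: U_def)
      have "m \<le> m + u" "u \<le> m + u" using nonneg[of m] nonneg[of u] by simp_all
      then have "m < n" "u < n" using n(1) by (metis le_less_trans)+
      then show "\<exists>n>m. n \<in> ?Z" using n by blast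
    qed
    moreover have "\<exists>b. \<forall>y\<in>?Z. z \<preceq> y \<longrightarrow> y < b" if "z \<in> ?Z" for z
    proof -
      have "z \<notin> U" using u_max[of z] that by auto
      then show ?thesis using bound[of z] that by auto
    qed
    ultimately show ?thesis by (intro bexI[of _ ?Z]) auto
  qed
qed

end

text \<open>
  Thinning out in both directions would leave an unbounded set whose elements are each comparable
  with boundedly many others.
\<close>

lemma (in order_structure) ideal_or_filter:
  assumes "unbounded {x. x \<preceq> x}"
  shows "\<exists>D\<in>S. ideal D \<or> order_structure.ideal (\<lambda>x y. y \<preceq> x) D"
proof (rule ccontr)
  interpret dual: order_structure S "\<lambda>x y. y \<preceq> x" by (rule dual_order_structure)
  assume no: "\<not> ?thesis"
  have "{x. x \<preceq> x} \<in> S" by (intro comprehension_arith arith_intros arith_order)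
  then obtain Z where Z: "Z \<in> S" "Z \<subseteq> {x. x \<preceq> x}" "unbounded Z" 
    "\<forall>z\<in>Z. \<exists>b. \<forall>y\<in>Z. z \<preceq> y \<longrightarrow> y < b"
    using thin_out[OF _ assms] no by blast
  then obtain Z' where Z': "Z' \<in> S" "Z' \<subseteq> Z" "unbounded Z'"
    "\<forall>z\<in>Z'. \<exists>b. \<forall>y\<in>Z'. y \<preceq> z \<longrightarrow> y < b"
    using dual.thin_out[OF Z(1,3)] no by blast
  show False
  proof (rule no_sparse_set[OF Z'(1,3)])
    show "z \<preceq> z" if "z \<in> Z'" for z using that Z Z' by blast
    fix z assume "z \<in> Z'"
    then obtain b b' where "\<forall>y\<in>Z'. z \<preceq> y \<longrightarrow> y < b" "\<forall>y\<in>Z'. y \<preceq> z \<longrightarrow> y < b'"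
      using Z(4) Z'(2,4) by blast
    moreover have "y < b + b'" if "y < b \<or> y < b'" for y
      using that add_less_le_mono[of y b 0 b'] add_le_less_mono[of 0 b y b'] nonneg by auto
    ultimately show "\<exists>b. \<forall>y\<in>Z'. y \<preceq> z \<or> z \<preceq> y \<longrightarrow> y < b" by blast
  qed
qed

context order_structure
begin

section \<open>Homogeneous chains\<close>

text \<open>
  The definition is symmetric in the order, so it suffices to find a homogeneous chain in the order
  or in its dual.
\<close>

definition homogeneous :: "'a set \<Rightarrow> bool" where
  "homogeneous C \<longleftrightarrow> unbounded C \<and> (\<forall>x\<in>C. x \<preceq> x) \<and> (\<forall>x\<in>C. \<forall>y\<in>C. x \<preceq> y \<or> y \<preceq> x) \<and>
     (\<forall>p c. c \<in> C \<longrightarrow> p \<preceq> c \<or> c \<preceq> p \<longrightarrow> unbounded {x. x \<in> C \<and> (p \<preceq> x \<or> x \<preceq> p)})"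

definition ascending :: "('a \<Rightarrow> 'a) \<Rightarrow> bool" where
  "ascending h \<longleftrightarrow> fun1 h \<and> (\<forall>i j. i \<le> j \<longrightarrow> h i \<preceq> h j) \<and> (\<forall>i j. i < j \<longrightarrow> h i \<noteq> h j)"

lemma ascending_unbounded:
  assumes "ascending h" "\<And>i. n \<le> i \<Longrightarrow> h i \<in> X"
  shows "unbounded X"
  unfolding unbounded_def
proof
  fix m
  have "\<exists>k\<ge>n. m < h k"
    by (rule injective_unbounded) (use assms(1) in \<open>simp_all add: ascending_def\<close>)
  then show "\<exists>x>m. x \<in> X" using assms(2) by blast
qed

text \<open>
  The choice at step \<open>n\<close> goes strictly up, and above \<open>n\<close> itself if \<open>n\<close> belongs to \<open>D\<close>.
\<close>

lemma cofinal_sequence: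
  assumes "D \<in> S" "ideal D" "d \<in> D"
  obtains h where "ascending h" "h 0 = d" "\<And>n. h n \<in> D" "\<And>x. x \<in> D \<Longrightarrow> \<exists>n. x \<preceq> h n"
proof -
  let ?R = "\<lambda>n x y. x \<preceq> y \<and> x \<noteq> y \<and> (n \<in> D \<longrightarrow> n \<preceq> y)"
  note intros = arith_intros arith_order arith_mem[OF assms(1)]
  have step: "\<exists>y. y \<in> D \<and> ?R n x y" if x: "x \<in> D" for n x
  proof -
    obtain y where y: "y \<in> D" "x \<preceq> y" "x \<noteq> y" using assms(2) x unfolding ideal_def by metis
    obtain z where z: "z \<in> D" "y \<preceq> z" "n \<in> D \<longrightarrow> n \<preceq> z"
      using assms(2) y(1) unfolding ideal_def by metis
    have "x \<noteq> z" using y z le_antisym by metis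
    with y z show ?thesis using le_trans by metis
  qed
  have "\<exists>h. fun1 h \<and> h 0 = d \<and> (\<forall>n. h n \<in> D \<and> ?R n (h n) (h (n + 1)))"
  proof (rule dependent_choice)
    show "arith (\<lambda>e. e 0 \<in> D)" by (intro intros)
    show "arith (\<lambda>e. ?R (e 0) (e 1) (e 2))" by (intro intros)
    show "d \<in> D" by (rule assms(3))
    show "\<exists>y. y \<in> D \<and> ?R n x y" if "x \<in> D" for n x by (rule step[OF that])
  qed
  then obtain h where h: "fun1 h" "h 0 = d" "\<And>n. h n \<in> D" "\<And>n. ?R n (h n) (h (n + 1))"
    by metis
  have refl: "h n \<preceq> h n" for n using h(3) assms(2) unfolding ideal_def by blast
  have mono: "h i \<preceq> h j" if "i \<le> j" for i j
    by (rule monotone_sequence[OF le_rel2 h(1) _ _ le_trans that]) (use refl h(4) in auto)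
  have "h i \<noteq> h j" if ij: "i < j" for i j
  proof -
    obtain k where k: "j = k + 1" "i \<le> k" using less_cases_succ[OF ij] by metis
    have "h i \<preceq> h k" "h k \<preceq> h j" "h k \<noteq> h j" using mono[OF k(2)] h(4)[of k] k(1) by auto
    then show ?thesis using le_antisym by metis
  qed
  with mono h(1) have "ascending h" unfolding ascending_def by simp
  moreover have "\<exists>n. x \<preceq> h n" if "x \<in> D" for x
    using h(4)[of x] that by blast
  ultimately show ?thesis using that h(2,3) by metis
qed

definition upper_bound :: "'a set \<Rightarrow> 'a \<Rightarrow> bool" where
  "upper_bound D p \<longleftrightarrow> (\<forall>a\<in>D. a \<preceq> p)"

definition child :: "'a set \<Rightarrow> 'a \<Rightarrow> 'a set" where
  "child D v = {q. v \<preceq> q \<and> \<not> upper_bound D q}"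

text \<open>
  The elements that spoil a cofinal chain of \<open>D\<close> from \<open>c\<close> on: an element below a member of the
  chain, or above all of them, is comparable with unboundedly many.
\<close>

lemma exists_obstruction:
  assumes none: "\<And>C. C \<in> S \<Longrightarrow> \<not> homogeneous C"
    and D: "D \<in> S" "ideal D" "c \<in> D"
  shows "\<exists>p. c \<preceq> p \<and> \<not> upper_bound D p \<and> (\<forall>a\<in>D. \<not> p \<preceq> a)"
proof (rule ccontr)
  assume no: "\<not> ?thesis"
  obtain h where h: "ascending h" "h 0 = c" "\<And>n. h n \<in> D" "\<And>x. x \<in> D \<Longrightarrow> \<exists>n. x \<preceq> h n"
    by (rule cofinal_sequence[OF D]) blast
  have h_mono: "h i \<preceq> h j" if "i \<le> j" for i j using h(1) that unfolding ascending_def by simp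
  have "fun1 h" using h(1) unfolding ascending_def by simp
  let ?C = "{x. \<exists>n. x = h n}"
  have "?C \<in> S"
    by (intro comprehension_arith arith_intros fun1_app[OF \<open>fun1 h\<close>])
  moreover have "homogeneous ?C"
    unfolding homogeneous_def
  proof (intro conjI ballI allI impI)
    show "unbounded ?C" by (rule ascending_unbounded[OF h(1)]) blast
    show "x \<preceq> x" if "x \<in> ?C" for x using that h_mono by auto
    have "h i \<preceq> h j \<or> h j \<preceq> h i" for i j using h_mono linear[of i j] by metis
    then show "x \<preceq> y \<or> y \<preceq> x" if "x \<in> ?C" "y \<in> ?C" for x y using that by auto
    fix p x assume "x \<in> ?C" and comp: "p \<preceq> x \<or> x \<preceq> p"
    then obtain i where x: "x = h i" by blast
    have "\<exists>n. \<forall>k\<ge>n. p \<preceq> h k \<or> h k \<preceq> p"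
    proof (cases "\<exists>n. p \<preceq> h n")
      case True
      then show ?thesis using h_mono le_trans by metis
    next
      case False
      then have "h i \<preceq> p" using comp x by blast
      moreover have "c \<preceq> h i" using h_mono[OF nonneg] h(2) by metis
      ultimately have "c \<preceq> p" using le_trans by metis
      moreover have "\<forall>a\<in>D. \<not> p \<preceq> a" using False h(4) le_trans by metis
      ultimately have "upper_bound D p" using no by metis
      then show ?thesis using h(3) unfolding upper_bound_def by simp
    qed
    then obtain n where "\<forall>k\<ge>n. p \<preceq> h k \<or> h k \<preceq> p" by metis
    then show "unbounded {y. y \<in> ?C \<and> (p \<preceq> y \<or> y \<preceq> p)}"
      by (intro ascending_unbounded[OF h(1), of n]) auto
  qed
  ultimately show False using none[of ?C] by iprover
qed

text \<open>
  Two applications of \<open>compatible_above\<close>. In the first, \<open>X\<close> is the set of non-upper-bounds and \<open>C\<close>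
  is a tail of \<open>D\<close>: above \<open>c\<close>, every non-upper-bound is compatible, through a non-upper-bound,
  with every member of \<open>D\<close>. This excludes a maximum of the child, since such an element would bound
  \<open>D\<close>. In the second, \<open>X\<close> and \<open>C\<close> are both the set of non-upper-bounds above \<open>p\<close>, which gives the
  \<open>v\<close> that makes the child directed.
\<close>

lemma child_ideal:
  assumes D: "D \<in> S" "ideal D" "d \<in> D"
  shows "\<exists>c\<in>D. d \<preceq> c \<and> (\<forall>p. c \<preceq> p \<longrightarrow> \<not> upper_bound D p \<longrightarrow> (\<exists>v. p \<preceq> v \<and> ideal (child D v)))"
proof -
  note intros = arith_intros arith_order arith_mem[OF D(1)]
  let ?X = "{q. q \<preceq> q \<and> \<not> upper_bound D q}"
  let ?C = "{a. a \<in> D \<and> d \<preceq> a}"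
  have X: "?X \<in> S" and C: "?C \<in> S" unfolding upper_bound_def by (intro comprehension_arith intros)+
  have D_refl: "a \<preceq> a" if "a \<in> D" for a using D(2) that unfolding ideal_def by blast
  have "d \<in> ?C" using D(3) D_refl by simp
  then have "\<exists>c\<in>?C. \<forall>x\<in>?X. \<forall>c'\<in>?C. c \<preceq> x \<longrightarrow> c \<preceq> c' \<longrightarrow> (\<exists>z\<in>?X. x \<preceq> z \<and> c' \<preceq> z)"
    by (rule compatible_above[OF X C]) (use D_refl in auto)
  then obtain c where c: "c \<in> D" "d \<preceq> c"
    and c_ex: "\<forall>x\<in>?X. \<forall>c'\<in>?C. c \<preceq> x \<longrightarrow> c \<preceq> c' \<longrightarrow> (\<exists>z\<in>?X. x \<preceq> z \<and> c' \<preceq> z)"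
    by auto
  have extend: "\<exists>z. \<not> upper_bound D z \<and> w \<preceq> z \<and> a \<preceq> z"
    if w: "c \<preceq> w" "\<not> upper_bound D w" and a: "a \<in> D" for w a
  proof -
    obtain c' where c': "c' \<in> D" "a \<preceq> c'" "c \<preceq> c'"
      using D(2) a c(1) unfolding ideal_def by metis
    then have "c' \<in> ?C" using le_trans[OF c(2)] by simp
    moreover have "w \<in> ?X" using w le_field[OF w(1)] by simp
    ultimately have "\<exists>z\<in>?X. w \<preceq> z \<and> c' \<preceq> z"
      using c_ex[rule_format, OF _ _ w(1) c'(3)] by iprover
    then obtain z where "z \<in> ?X" "w \<preceq> z" "c' \<preceq> z" by (elim bexE conjE)
    with c'(2) show ?thesis using le_trans[of a c' z] by auto
  qed
  have "\<exists>v. p \<preceq> v \<and> ideal (child D v)" if p: "c \<preceq> p" "\<not> upper_bound D p" for p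
  proof -
    let ?Y = "{q. p \<preceq> q \<and> \<not> upper_bound D q}"
    have Y: "?Y \<in> S" unfolding upper_bound_def by (intro comprehension_arith intros)
    have "p \<in> ?Y" using p le_field[OF p(1)] by simp
    then have "\<exists>v\<in>?Y. \<forall>x\<in>?Y. \<forall>y\<in>?Y. v \<preceq> x \<longrightarrow> v \<preceq> y \<longrightarrow> (\<exists>z\<in>?Y. x \<preceq> z \<and> y \<preceq> z)"
      by (rule compatible_above[OF Y Y]) (use le_field in auto)
    then obtain v where v: "p \<preceq> v" "\<not> upper_bound D v"
      and v_ex: "\<forall>x\<in>?Y. \<forall>y\<in>?Y. v \<preceq> x \<longrightarrow> v \<preceq> y \<longrightarrow> (\<exists>z\<in>?Y. x \<preceq> z \<and> y \<preceq> z)"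
      by auto
    have child_iff: "x \<in> child D v \<longleftrightarrow> v \<preceq> x \<and> \<not> upper_bound D x" for x
      by (simp add: child_def)
    have directed: "\<exists>z\<in>child D v. x \<preceq> z \<and> y \<preceq> z"
      if x: "x \<in> child D v" and y: "y \<in> child D v" for x y
    proof -
      have "x \<in> ?Y" "y \<in> ?Y" "v \<preceq> x" "v \<preceq> y"
        using x y le_trans[OF v(1)] by (simp_all add: child_iff)
      then have "\<exists>z\<in>?Y. x \<preceq> z \<and> y \<preceq> z" using v_ex[rule_format, of x y] by iprover
      then obtain z where z: "z \<in> ?Y" "x \<preceq> z" "y \<preceq> z" by (elim bexE conjE)
      then have "z \<in> child D v" using le_trans[OF \<open>v \<preceq> x\<close>] by (simp add: child_iff)
      with z show ?thesis by blast
    qed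
    have no_max: "\<exists>y\<in>child D v. x \<preceq> y \<and> x \<noteq> y" if x: "x \<in> child D v" for x
    proof -
      obtain a where a: "a \<in> D" "\<not> a \<preceq> x" using x unfolding child_iff upper_bound_def by metis
      have vx: "v \<preceq> x" "\<not> upper_bound D x" using x by (simp_all add: child_iff)
      have "c \<preceq> x" using le_trans[OF p(1) le_trans[OF v(1) vx(1)]] .
      then obtain z where z: "\<not> upper_bound D z" "x \<preceq> z" "a \<preceq> z"
        using extend[OF _ vx(2) a(1)] by metis
      then have "z \<in> child D v" using le_trans[OF vx(1)] by (simp add: child_iff)
      moreover have "x \<noteq> z" using z(3) a(2) by metis
      ultimately show ?thesis using z(2) by blast
    qed
    have "v \<in> child D v" using v le_field[OF v(1)] by (simp add: child_iff)
    moreover have "x \<preceq> x" if "x \<in> child D v" for x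
      using that le_field[of v x] by (simp add: child_iff)
    ultimately have "ideal (child D v)"
      unfolding ideal_def using directed no_max by simp blast
    with v(1) show ?thesis by blast
  qed
  with c show ?thesis by blast
qed

text \<open>
  The result of passing \<open>j\<close> times to a child, with the vertices coded by \<open>s\<close> (see \<open>descendant_0\<close> and
  \<open>descendant_succ\<close>). A direct recursion on sets would not be arithmetical. But membership of \<open>p\<close>
  in a child asks for just one member of the parent that is not below \<open>p\<close>, so membership after
  \<open>j\<close> steps is witnessed by a single finite sequence \<open>t\<close> of numbers ending in \<open>p\<close>.
\<close>

definition descendant :: "'a set \<Rightarrow> 'a \<Rightarrow> 'a \<Rightarrow> 'a set" where
  "descendant D s j = {p. \<exists>t. entry t j = p \<and> entry t 0 \<in> D \<and>
     (\<forall>i<j. entry s i \<preceq> entry t (i + 1) \<and> \<not> entry t i \<preceq> entry t (i + 1))}"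

lemma arith_descendant:
  assumes "D \<in> S" "fn p" "fn s" "fn j"
  shows "arith (\<lambda>e. p e \<in> descendant D (s e) (j e))"
proof (rule rel3_app[OF _ assms(2,3,4)])
  show "rel3 (\<lambda>p s j. p \<in> descendant D s j)"
    unfolding descendant_def mem_Collect_eq
    by (intro arith_intros arith_order arith_mem[OF assms(1)] fn_entry)
qed

lemma descendant_in_S: "D \<in> S \<Longrightarrow> descendant D s j \<in> S"
  using comprehension_arith[OF arith_descendant[OF _ fn_var fn_const fn_const]] by simp

lemma descendant_0: "descendant D s 0 = D"
proof -
  have "\<exists>t. entry t 0 = p" for p using extend_sequence_code by metis
  moreover have "\<not> i < 0" for i :: 'a using nonneg[of i] by simp
  ultimately have "p \<in> descendant D s 0 \<longleftrightarrow> p \<in> D" for p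
    unfolding descendant_def by (simp, metis)
  then show ?thesis by auto
qed

lemma descendant_cong:
  assumes "\<And>i. i < j \<Longrightarrow> entry s i = entry s' i"
  shows "descendant D s j = descendant D s' j"
  unfolding descendant_def using assms by (intro Collect_cong) (simp cong: conj_cong)

lemma descendant_succ:
  "descendant D s (j + 1) = child (descendant D s j) (entry s j)"
proof (intro set_eqI iffI)
  fix q assume "q \<in> descendant D s (j + 1)"
  then obtain t where t: "entry t (j + 1) = q" "entry t 0 \<in> D"
    "\<forall>i<j + 1. entry s i \<preceq> entry t (i + 1) \<and> \<not> entry t i \<preceq> entry t (i + 1)"
    unfolding descendant_def by auto
  have "i < j \<Longrightarrow> i < j + 1" for i by (rule less_trans[OF _ less_add_one])
  with t(2,3) have "entry t j \<in> descendant D s j" unfolding descendant_def by auto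
  moreover have "entry s j \<preceq> q" "\<not> entry t j \<preceq> q" using t(1,3) by auto
  ultimately show "q \<in> child (descendant D s j) (entry s j)"
    unfolding child_def upper_bound_def by auto
next
  fix q assume "q \<in> child (descendant D s j) (entry s j)"
  then obtain a where a: "a \<in> descendant D s j" "\<not> a \<preceq> q" "entry s j \<preceq> q"
    unfolding child_def upper_bound_def by auto
  then obtain t where t: "entry t j = a" "entry t 0 \<in> D"
    "\<forall>i<j. entry s i \<preceq> entry t (i + 1) \<and> \<not> entry t i \<preceq> entry t (i + 1)"
    unfolding descendant_def by auto
  obtain t' where t': "\<forall>i<j + 1. entry t' i = entry t i" "entry t' (j + 1) = q"
    using extend_sequence_code by metis
  have "entry s i \<preceq> entry t' (i + 1) \<and> \<not> entry t' i \<preceq> entry t' (i + 1)" if "i < j + 1" for i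
  proof (cases "i = j")
    case True
    then show ?thesis using a t(1) t' by simp
  next
    case False
    then have "i < j" using that less_plus_one_iff[of i j] by simp
    then show ?thesis using t(3) t'(1) that by simp
  qed
  moreover have "entry t' 0 \<in> D" using t(2) t'(1) nonneg[of j] by (simp add: less_plus_one_iff)
  ultimately show "q \<in> descendant D s (j + 1)" using t'(2) unfolding descendant_def by auto
qed

text \<open>
  The chain sought has order type \<open>\<omega> + \<omega>\<close>: the lower part is cofinal in a descendant \<open>A\<close>, and the
  upper part covers all elements that could spoil the lower part. These elements lie in \<open>U\<close>, which
  need not be contained in any one descendant.
\<close>

theorem ideal_homogeneous_chain:
  assumes D\<^sub>0: "D\<^sub>0 \<in> S" "ideal D\<^sub>0"
  shows "\<exists>C\<in>S. homogeneous C"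
proof (rule ccontr)
  assume "\<not> ?thesis"
  then have none: "\<not> homogeneous C" if "C \<in> S" for C using that by metis
  let ?D = "descendant D\<^sub>0"
  have DS: "?D s j \<in> S" for s j by (rule descendant_in_S[OF D\<^sub>0(1)])
  define U where "U = {y. \<exists>s j. ideal (?D s j) \<and> (\<exists>a\<in>?D s j. y \<preceq> a)}"
  have "U \<in> S"
    unfolding U_def ideal_def
    by (intro comprehension_arith arith_intros arith_order arith_descendant[OF D\<^sub>0(1)])
  have in_U: "x \<in> U" if "ideal (?D s j)" "a \<in> ?D s j" "x \<preceq> a" for x s j a
    using that unfolding U_def by auto
  have U_refl: "x \<preceq> x" if "x \<in> U" for x
    using that le_field unfolding U_def by auto
  have ideal_refl: "x \<preceq> x" if "ideal E" "x \<in> E" for E x using that unfolding ideal_def by metis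
  have branch: "\<exists>c\<in>?D s j. d \<preceq> c \<and> (\<forall>p. c \<preceq> p \<longrightarrow> \<not> upper_bound (?D s j) p \<longrightarrow>
      (\<exists>s' v. p \<preceq> v \<and> ?D s' (j + 1) = child (?D s j) v \<and> ideal (?D s' (j + 1))))"
    if D: "ideal (?D s j)" "d \<in> ?D s j" for s j d
  proof -
    obtain c where c: "c \<in> ?D s j" "d \<preceq> c"
      "\<forall>p. c \<preceq> p \<longrightarrow> \<not> upper_bound (?D s j) p \<longrightarrow> (\<exists>v. p \<preceq> v \<and> ideal (child (?D s j) v))"
      using child_ideal[OF DS D] by metis
    have realize: "\<exists>s'. ?D s' (j + 1) = child (?D s j) v" for v
    proof -
      obtain s' where s': "\<forall>i<j. entry s' i = entry s i" "entry s' j = v"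
        using extend_sequence_code by metis
      then have "?D s' j = ?D s j" by (intro descendant_cong) simp
      with s'(2) show ?thesis using descendant_succ by metis
    qed
    show ?thesis
    proof (intro bexI conjI allI impI)
      fix p assume "c \<preceq> p" "\<not> upper_bound (?D s j) p"
      then obtain v where v: "p \<preceq> v" "ideal (child (?D s j) v)" using c(3) by metis
      obtain s' where "?D s' (j + 1) = child (?D s j) v" using realize by metis
      with v show "\<exists>s' v. p \<preceq> v \<and> ?D s' (j + 1) = child (?D s j) v \<and> ideal (?D s' (j + 1))"
        by metis
    qed (fact c)+
  qed
  have below_child: "p \<in> U" if "p \<preceq> v" "?D s j = child E v" "ideal (?D s j)" for p v s j E
  proof -
    obtain b where b: "b \<in> ?D s j" using \<open>ideal (?D s j)\<close> unfolding ideal_def by metis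
    then have "v \<preceq> b" using \<open>?D s j = child E v\<close> unfolding child_def by simp
    with \<open>p \<preceq> v\<close> have "p \<preceq> b" by (rule le_trans)
    with b \<open>ideal (?D s j)\<close> show ?thesis by (intro in_U)
  qed
  obtain u where u: "u \<in> D\<^sub>0" using D\<^sub>0(2) unfolding ideal_def by metis
  have "u \<in> U"
    by (rule in_U[of 0 0 u]) (use u D\<^sub>0(2) ideal_refl in \<open>simp_all add: descendant_0\<close>)
  then have "\<exists>y\<in>U. \<forall>x\<in>U. \<forall>x'\<in>U. y \<preceq> x \<longrightarrow> y \<preceq> x' \<longrightarrow> (\<exists>z\<in>U. x \<preceq> z \<and> x' \<preceq> z)"
    by (rule compatible_above[OF \<open>U \<in> S\<close> \<open>U \<in> S\<close> _ U_refl U_refl])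
  then obtain y where y: "y \<in> U"
    "\<forall>x\<in>U. \<forall>x'\<in>U. y \<preceq> x \<longrightarrow> y \<preceq> x' \<longrightarrow> (\<exists>z\<in>U. x \<preceq> z \<and> x' \<preceq> z)" ..
  \<comment> \<open>\<open>G\<close> is directed by the choice of \<open>y\<close>. It has no maximum because every member of \<open>U\<close> lies
    below a member of an ideal contained in \<open>U\<close>.\<close>
  define G where "G = {x. x \<in> U \<and> y \<preceq> x}"
  have "G \<in> S" unfolding G_def
    by (intro comprehension_arith arith_intros arith_order arith_mem[OF \<open>U \<in> S\<close>])
  have G_iff: "x \<in> G \<longleftrightarrow> x \<in> U \<and> y \<preceq> x" for x by (simp add: G_def)
  have "ideal G"
    unfolding ideal_def
  proof (intro conjI ballI)
    show "\<exists>x. x \<in> G" using y(1) U_refl G_iff by metis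
    show "x \<preceq> x" if "x \<in> G" for x using that U_refl G_iff by metis
    show "\<exists>z\<in>G. x \<preceq> z \<and> x' \<preceq> z" if x: "x \<in> G" "x' \<in> G" for x x'
    proof -
      obtain z where z: "z \<in> U" "x \<preceq> z" "x' \<preceq> z" using y(2) x G_iff by metis
      moreover have "y \<preceq> z" using x(1) z(2) le_trans G_iff by metis
      ultimately show ?thesis using G_iff by metis
    qed
    show "\<exists>z\<in>G. x \<preceq> z \<and> x \<noteq> z" if x: "x \<in> G" for x
    proof -
      obtain s j a where a: "ideal (?D s j)" "a \<in> ?D s j" "x \<preceq> a" and "y \<preceq> x"
        using x unfolding G_iff U_def by auto
      then obtain b where b: "b \<in> ?D s j" "a \<preceq> b" "a \<noteq> b" unfolding ideal_def by metis
      have "b \<in> U" by (rule in_U[OF a(1) b(1) ideal_refl[OF a(1) b(1)]])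
      moreover have "x \<preceq> b" using a(3) b(2) by (rule le_trans)
      moreover have "x \<noteq> b" using a(3) b(2,3) le_antisym by metis
      moreover have "y \<preceq> b" using \<open>y \<preceq> x\<close> \<open>x \<preceq> b\<close> by (rule le_trans)
      ultimately show ?thesis using G_iff by metis
    qed
  qed
  obtain s j a where a: "ideal (?D s j)" "a \<in> ?D s j" "y \<preceq> a"
    using y(1) unfolding U_def by auto
  let ?A = "?D s j"
  obtain c where c: "c \<in> ?A" "a \<preceq> c" and c_branch:
    "\<forall>p. c \<preceq> p \<longrightarrow> \<not> upper_bound ?A p \<longrightarrow>
      (\<exists>s' v. p \<preceq> v \<and> ?D s' (j + 1) = child ?A v \<and> ideal (?D s' (j + 1)))"
    using branch[OF a(1,2)] by metis
  have "y \<preceq> c" using a(3) c(2) by (rule le_trans)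
  have in_G: "p \<in> G" if p: "c \<preceq> p" "\<not> upper_bound ?A p" for p
  proof -
    obtain s' v where "p \<preceq> v" "?D s' (j + 1) = child ?A v" "ideal (?D s' (j + 1))"
      using c_branch p by metis
    then have "p \<in> U" by (rule below_child)
    then show ?thesis using le_trans[OF \<open>y \<preceq> c\<close> p(1)] G_iff by metis
  qed
  \<comment> \<open>An obstruction to a child of \<open>A\<close> is not in the child although it lies above the vertex,
    so it bounds \<open>A\<close>.\<close>
  obtain w where w: "w \<in> G" "upper_bound ?A w"
  proof -
    obtain p where p: "c \<preceq> p" "\<not> upper_bound ?A p"
      using exists_obstruction[OF none DS a(1) c(1)] by metis
    then obtain s' v where v: "p \<preceq> v" "?D s' (j + 1) = child ?A v" "ideal (?D s' (j + 1))"
      using c_branch by metis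
    let ?B = "?D s' (j + 1)"
    have child_iff: "q \<in> ?B \<longleftrightarrow> v \<preceq> q \<and> \<not> upper_bound ?A q" for q
      unfolding v(2) by (simp add: child_def)
    obtain d where "d \<in> ?B" using v(3) unfolding ideal_def by metis
    then obtain c' where c': "c' \<in> ?B" and c'_branch:
      "\<forall>p. c' \<preceq> p \<longrightarrow> \<not> upper_bound ?B p \<longrightarrow>
        (\<exists>s'' v. p \<preceq> v \<and> ?D s'' (j + 1 + 1) = child ?B v \<and> ideal (?D s'' (j + 1 + 1)))"
      using branch[OF v(3)] by metis
    obtain p' where p': "c' \<preceq> p'" "\<not> upper_bound ?B p'" "\<forall>b\<in>?B. \<not> p' \<preceq> b"
      using exists_obstruction[OF none DS v(3) c'] by metis
    obtain s'' v' where "p' \<preceq> v'" "?D s'' (j + 1 + 1) = child ?B v'" "ideal (?D s'' (j + 1 + 1))"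
      using c'_branch p'(1,2) by metis
    then have "p' \<in> U" by (rule below_child)
    have "v \<preceq> p'" using le_trans[OF _ p'(1)] c' child_iff by metis
    then have "y \<preceq> p'" using le_trans[OF \<open>y \<preceq> c\<close> le_trans[OF p(1) le_trans[OF v(1)]]] by metis
    then have "p' \<in> G" using \<open>p' \<in> U\<close> G_iff by metis
    moreover have "upper_bound ?A p'"
      using \<open>v \<preceq> p'\<close> child_iff[of p'] p'(3) le_field[OF \<open>v \<preceq> p'\<close>] by metis
    ultimately show ?thesis by (rule that)
  qed
  obtain h where h: "ascending h" "h 0 = c" "\<And>n. h n \<in> ?A"
    by (rule cofinal_sequence[OF DS a(1) c(1)]) metis
  obtain k where k: "ascending k" "k 0 = w" "\<And>n. k n \<in> G" "\<And>x. x \<in> G \<Longrightarrow> \<exists>n. x \<preceq> k n"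
    by (rule cofinal_sequence[OF \<open>G \<in> S\<close> \<open>ideal G\<close> w(1)]) metis
  have h_mono: "h m \<preceq> h n" if "m \<le> n" for m n using h(1) that unfolding ascending_def by simp
  have k_mono: "k m \<preceq> k n" if "m \<le> n" for m n using k(1) that unfolding ascending_def by simp
  have h_k: "h m \<preceq> k n" for m n
  proof -
    have "h m \<preceq> w" using w(2) h(3) unfolding upper_bound_def by metis
    moreover have "w \<preceq> k n" using k_mono[of 0 n] k(2) nonneg by simp
    ultimately show ?thesis by (rule le_trans)
  qed
  let ?C = "{x. (\<exists>n. x = h n) \<or> (\<exists>n. x = k n)}"
  have hk: "fun1 h" "fun1 k" using h(1) k(1) unfolding ascending_def by simp_all
  have "?C \<in> S" by (intro comprehension_arith arith_intros fun1_app[OF hk(1)] fun1_app[OF hk(2)])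
  moreover have "homogeneous ?C"
    unfolding homogeneous_def
  proof (intro conjI ballI allI impI)
    show "unbounded ?C" by (rule ascending_unbounded[OF h(1)]) blast
    show "x \<preceq> x" if "x \<in> ?C" for x using that h_mono k_mono by auto
    have hh: "h m \<preceq> h n \<or> h n \<preceq> h m" and kk: "k m \<preceq> k n \<or> k n \<preceq> k m" for m n
      using h_mono k_mono linear[of m n] by metis+
    show "x \<preceq> x' \<or> x' \<preceq> x" if "x \<in> ?C" "x' \<in> ?C" for x x'
      using that hh kk h_k by auto
    fix p x assume x: "x \<in> ?C" and comp: "p \<preceq> x \<or> x \<preceq> p"
    let ?E = "{z. z \<in> ?C \<and> (p \<preceq> z \<or> z \<preceq> p)}"
    have above_k: "unbounded ?E" if p: "p \<preceq> k n" for n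
    proof (rule ascending_unbounded[OF k(1), of n])
      fix i assume "n \<le> i"
      then have "p \<preceq> k i" using le_trans[OF p k_mono] by metis
      then show "k i \<in> ?E" by auto
    qed
    have below_h: "unbounded ?E" if p: "upper_bound ?A p"
    proof (rule ascending_unbounded[OF h(1), of 0])
      fix i
      have "h i \<preceq> p" using p h(3) unfolding upper_bound_def by metis
      then show "h i \<in> ?E" by auto
    qed
    show "unbounded ?E"
    proof (cases "\<exists>n. p \<preceq> k n")
      case True
      then show ?thesis using above_k by metis
    next
      case False
      then have "p \<notin> G" using k(4) by metis
      have "\<not> p \<preceq> h n" for n using False le_trans[OF _ h_k] by metis
      then have "\<not> p \<preceq> x" using x False by auto
      then have "x \<preceq> p" using comp by metis
      moreover have "c \<preceq> x" using x h_mono[of 0] h(2) h_k[of 0] nonneg by auto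
      ultimately have "c \<preceq> p" using le_trans by metis
      then show ?thesis using in_G[of p] \<open>p \<notin> G\<close> below_h by metis
    qed
  qed
  ultimately show False using none[of ?C] by iprover
qed

lemma homogeneous_chain_exists:
  assumes "unbounded {x. x \<preceq> x}"
  shows "\<exists>C\<in>S. homogeneous C"
proof -
  interpret dual: order_structure S "\<lambda>x y. y \<preceq> x" by (rule dual_order_structure)
  have sym: "{x. x \<in> C \<and> (p \<preceq> x \<or> x \<preceq> p)} = {x. x \<in> C \<and> (x \<preceq> p \<or> p \<preceq> x)}" for p C by auto
  have dual: "homogeneous C" if "dual.homogeneous C" for C
    using that unfolding homogeneous_def dual.homogeneous_def sym by auto
  obtain D where "D \<in> S" "ideal D \<or> dual.ideal D" using ideal_or_filter[OF assms] by metis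
  then show ?thesis
    using ideal_homogeneous_chain dual.ideal_homogeneous_chain dual by metis
qed

end

section \<open>The theorem\<close>

lemma (in aca_structure) rival_sands_holds: "holds S e f rival_sands_fm"
proof -
  have idx: "case_nat a g 1 = g 0" "case_nat a g 2 = g 1" for a :: 'b and g
    by (simp_all add: numeral_2_eq_2)
  define lt where "lt L p q \<longleftrightarrow> code p q \<in> L" for L p q
  define comp where "comp L p q \<longleftrightarrow> (lt L p q \<or> p = q) \<or> (lt L q p \<or> q = p)" for L p q
  have main: "\<exists>C\<in>S. ((\<forall>m. \<exists>n. m < n \<and> n \<in> C) \<and> (\<forall>p. p \<in> C \<longrightarrow> p \<in> P) \<and>
        (\<forall>p q. p \<in> C \<and> q \<in> C \<longrightarrow> comp L p q)) \<and>
        (\<forall>p. p \<in> P \<longrightarrow> \<not> (\<exists>c. c \<in> C \<and> comp L p c) \<or> (\<forall>m. \<exists>c. m < c \<and> c \<in> C \<and> comp L p c))"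
    if PL: "P \<in> S" "L \<in> S"
      and irrefl: "\<forall>p. p \<in> P \<longrightarrow> \<not> lt L p p"
      and trans: "\<forall>p q r. p \<in> P \<and> q \<in> P \<and> r \<in> P \<longrightarrow> lt L p q \<and> lt L q r \<longrightarrow> lt L p r"
      and inf: "\<forall>m. \<exists>n. m < n \<and> n \<in> P"
      and anti: "\<not> (\<exists>A\<in>S. (\<forall>m. \<exists>n. m < n \<and> n \<in> A) \<and> (\<forall>p. p \<in> A \<longrightarrow> p \<in> P) \<and>
         (\<forall>p q. p \<in> A \<and> q \<in> A \<and> \<not> p = q \<longrightarrow> \<not> comp L p q))"
    for P L
  proof -
    let ?le = "\<lambda>x y. x \<in> P \<and> y \<in> P \<and> (code x y \<in> L \<or> x = y)"
    interpret order_structure S ?le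
    proof
      show "rel2 ?le" by (intro arith_intros arith_mem[OF PL(1)] arith_mem[OF PL(2)] fn_code)
      show "?le x z" if "?le x y" "?le y z" for x y z
        using that trans unfolding lt_def by metis
      show "x = y" if "?le x y" "?le y x" for x y
        using that trans irrefl unfolding lt_def by metis
      show "\<exists>x\<in>A. \<exists>y\<in>A. x \<noteq> y \<and> ?le x y"
        if A: "A \<in> S" "unbounded A" "\<And>x. x \<in> A \<Longrightarrow> ?le x x" for A
      proof -
        have "\<exists>x y. x \<in> A \<and> y \<in> A \<and> x \<noteq> y \<and> comp L x y"
          using anti
        proof (rule contrapos_np)
          assume no: "\<not> (\<exists>x y. x \<in> A \<and> y \<in> A \<and> x \<noteq> y \<and> comp L x y)"
          show "\<exists>A\<in>S. (\<forall>m. \<exists>n. m < n \<and> n \<in> A) \<and> (\<forall>p. p \<in> A \<longrightarrow> p \<in> P) \<and>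
              (\<forall>p q. p \<in> A \<and> q \<in> A \<and> \<not> p = q \<longrightarrow> \<not> comp L p q)"
          proof (intro bexI[OF _ A(1)] conjI)
            show "\<forall>m. \<exists>n. m < n \<and> n \<in> A" using A(2) unfolding unbounded_def by simp
            show "\<forall>p. p \<in> A \<longrightarrow> p \<in> P" using A(3) by simp
            show "\<forall>p q. p \<in> A \<and> q \<in> A \<and> \<not> p = q \<longrightarrow> \<not> comp L p q" using no by iprover
          qed
        qed
        then obtain x y where xy: "x \<in> A" "y \<in> A" "x \<noteq> y" "comp L x y" by auto
        then have "x \<in> P" "y \<in> P" using A(3) by simp_all
        then have "?le x y \<or> ?le y x" using xy(3,4) unfolding comp_def lt_def by auto
        then show ?thesis
        proof
          assume "?le x y"
          then show ?thesis using xy by (intro bexI[of _ x] bexI[of _ y] conjI) simp_all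
        next
          assume "?le y x"
          then show ?thesis using xy by (intro bexI[of _ y] bexI[of _ x] conjI) simp_all
        qed
      qed
    qed simp_all
    have "unbounded {x. ?le x x}" using inf by (simp add: unbounded_def)
    then have "\<exists>C\<in>S. homogeneous C" by (rule homogeneous_chain_exists)
    then obtain C where C: "C \<in> S" "homogeneous C" ..
    have sub: "x \<in> P" if "x \<in> C" for x using C(2) that unfolding homogeneous_def by simp
    have comp_iff: "comp L p x \<longleftrightarrow> ?le p x \<or> ?le x p" if "p \<in> P" "x \<in> P" for p x
      using that unfolding comp_def lt_def by auto
    show ?thesis
    proof (intro bexI[OF _ C(1)] conjI allI impI)
      show "\<exists>n. m < n \<and> n \<in> C" for m using C(2) unfolding homogeneous_def unbounded_def by simp
      show "p \<in> P" if "p \<in> C" for p using sub that .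
      show "comp L p q" if "p \<in> C \<and> q \<in> C" for p q
      proof -
        have "\<forall>x\<in>C. \<forall>y\<in>C. ?le x y \<or> ?le y x" using C(2) unfolding homogeneous_def by iprover
        from bspec[OF bspec[OF this], of p q] that have "?le p q \<or> ?le q p" by iprover
        then show ?thesis using comp_iff[OF sub sub] that by simp
      qed
      fix p assume p: "p \<in> P"
      show "\<not> (\<exists>c. c \<in> C \<and> comp L p c) \<or> (\<forall>m. \<exists>c. m < c \<and> c \<in> C \<and> comp L p c)"
      proof (cases "\<exists>c. c \<in> C \<and> comp L p c")
        case True
        then obtain c where c: "c \<in> C" "comp L p c" by (elim exE conjE)
        then have "?le p c \<or> ?le c p" using comp_iff[OF p sub] by simp
        then have "unbounded {x. x \<in> C \<and> (?le p x \<or> ?le x p)}"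
          using C(2) c(1) unfolding homogeneous_def by iprover
        moreover have "{x. x \<in> C \<and> (?le p x \<or> ?le x p)} = {x. x \<in> C \<and> comp L p x}"
          by (intro Collect_cong conj_cong refl comp_iff[OF p sub, symmetric])
        ultimately show ?thesis unfolding unbounded_def by simp
      qed simp
    qed
  qed
  show ?thesis
    unfolding rival_sands_fm_def zero_inf_homogeneous_fm_def antichain_fm_def chain_fm_def
      partial_order_fm_def infinite_fm_def subset_fm_def comparable_def le_in_def lt_in_def
      pair_def holds.simps holds_defined value_in.simps idx nat.case
    by (intro ballI impI, elim conjE) (rule main[unfolded comp_def lt_def code_def])
qed

lemma term_model_aca: "aca_structure (range extension)"
proof
  show "0 \<le> x" for x :: elt using term_model_semiring(17)[of x] by (auto simp: less_eq_elt_def)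
  show "0 < x \<Longrightarrow> 1 \<le> x" for x :: elt using term_model_semiring(16)[of x] by (auto simp: less_eq_elt_def)
  show "range extension \<noteq> {}" by simp
  show "{x. holds (range extension) (case_nat x e) f p} \<in> range extension"
    if p: "arithmetical p" and f: "range f \<subseteq> range extension" for p f e
  proof -
    have "univ_closures (comprehension_ax p) \<subseteq> ACA0" using p by (auto simp: ACA0_def)
    from term_model_axiom[OF this f, of e]
    obtain X where X: "X \<in> range extension"
      and eq: "\<forall>n. n \<in> X \<longleftrightarrow> holds (range extension) (case_nat n e) (case_nat X f) (liftS p)"
      by (auto simp: comprehension_ax_def)
    have "holds (range extension) e' (case_nat X f) (liftS p) = holds (range extension) e' f p" for e'
      by (simp add: liftS_def holds_subst)
    with eq have "{x. holds (range extension) (case_nat x e) f p} = X" by auto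
    with X show ?thesis by simp
  qed
  show "x \<in> X" if X: "X \<in> range extension" "0 \<in> X" "\<And>x. x \<in> X \<Longrightarrow> x + 1 \<in> X" for X and x :: elt
  proof -
    \<comment> \<open>A vacuous quantifier turns membership in a set into a \<open>\<Sigma>\<close> formula of the induction scheme.\<close>
    let ?p = "ExN (Mem (Var 1) 0)"
    have "?p \<in> Sigma01" unfolding Sigma01_def by (auto intro: bounded.intros)
    then have "univ_closures (induction_ax ?p) \<subseteq> ACA0" by (auto simp: ACA0_def RCA0_def)
    moreover have "range (\<lambda>_. X) \<subseteq> range extension" using X(1) by auto
    ultimately have "holds (range extension) (\<lambda>_. 0) (\<lambda>_. X) (induction_ax ?p)"
      by (rule term_model_axiom)
    then show ?thesis
      using X(2,3) by (simp add: induction_ax_def instN_def holds_subst)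
  qed
qed

theorem theorem7p3:
  shows "ACA0 \<turnstile> rival_sands_fm"
proof (rule ccontr)
  assume "\<not> ACA0 \<turnstile> rival_sands_fm"
  then have "Neg rival_sands_fm \<in> completion"
    using completion(1) by (auto simp: base_theory_def)
  moreover have "fvN (Neg rival_sands_fm) = {}" "fvS (Neg rival_sands_fm) = {}"
    using fv_rival_sands by simp_all
  moreover have "range (\<lambda>_. extension 0) \<subseteq> range extension" by auto
  ultimately have "holds (range extension) (\<lambda>_. 0) (\<lambda>_. extension 0) (Neg rival_sands_fm)"
    using term_model_sentence by metis
  then show False
    using aca_structure.rival_sands_holds[OF term_model_aca] by simp
qed

end
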